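(* Let $N$ be a closed manifold of dimension $6$, and let $(g(t),h(t),\eta(t))$ be a solution to the flow $$\begin{aligned} \partial_tg&=\tfrac12h^{1/2}\Big(\mathrm{Ric}-\tfrac12\mathrm{Scal}\,g\Big)-\tfrac12\Big(\mathrm{Hess}(h^{1/2})-(\Delta h^{1/2})\,g\Big)-\tfrac18h^{-1}\Big(j(F)-\tfrac12|F|^2g\Big),\\ \partial_th&=-\tfrac14h^{-1/2}\mathrm{Scal}(g)-\tfrac18h^{-2}|F|^2,\\ \partial_t\eta&=\tfrac14\,d^*(h^{-1}F), \end{aligned}$$ where $F=d\eta$ and $j(F)_{ij}=F_{ik}F_j{}^k$. Then the flow exhibits the following properties: (1) The de Rham cohomology class $[F]\in H^2_{\mathrm{dR}}(N)$ of the curvature $2$-form $F=d\eta$ is preserved along the flow. (2) If the flow admits a stationary limit, the connection $\eta$ satisfies $d^*(h^{-1}F)=0$, and the scalar curvature of the base manifold satisfies $$\mathrm{Scal}(g)=-\tfrac12h^{-3/2}|F|^2\le0.$$ (3) The evolution of the volume form $d\mathrm{vol}_g$ of the base manifold $N$ is given by $$\partial_t(d\mathrm{vol}_g)=\Big(-\tfrac12h^{1/2}\mathrm{Scal}(g)+\tfrac54\Delta(h^{1/2})+\tfrac18h^{-1}|F|^2\Big)d\mathrm{vol}_g.$$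
   Context: $g(t)$ are Riemannian metrics on $N$, $h(t)>0$ are smooth functions on $N$, and $\eta(t)$ are connection $1$-forms on a principal $\mathbb S^1$-bundle over $N$; $F=d\eta$ is identified with a closed $2$-form on $N$, and $\partial_t\eta$ with a $1$-form on $N$. $\mathrm{Ric}$, $\mathrm{Scal}$, $\mathrm{Hess}$, $\Delta=\operatorname{tr}_g\mathrm{Hess}$, $d^*$ are taken with respect to $g(t)$. Here $|F|^2=F_{ij}F^{ij}$, so that $\operatorname{tr}_g(j(F))=|F|^2$. A stationary limit is a triple $(g,h,\eta)$ at which $\partial_tg=0$, $\partial_th=0$, $\partial_t\eta=0$, i.e. all right-hand sides vanish. *)

theory Defs
  imports "HOL-Analysis.Analysis"
begin

section \<open>Smooth functions between Euclidean spaces\<close>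

text \<open>On an open subset of a finite-dimensional space this is the usual notion of a
  \<open>C\<^sup>k\<close> map: iterated directional derivatives exist up to order \<open>k\<close> and are continuous.\<close>

fun Ck_on :: "nat \<Rightarrow> 'a::euclidean_space set \<Rightarrow> ('a \<Rightarrow> 'b::euclidean_space) \<Rightarrow> bool" where
  "Ck_on 0 S f = continuous_on S f"
| "Ck_on (Suc k) S f = ((\<forall>x\<in>S. f differentiable (at x)) \<and>
     (\<forall>v. Ck_on k S (\<lambda>x. frechet_derivative f (at x) v)))"

definition smooth_on :: "'a::euclidean_space set \<Rightarrow> ('a \<Rightarrow> 'b::euclidean_space) \<Rightarrow> bool" where
  "smooth_on S f \<longleftrightarrow> (\<forall>k. Ck_on k S f)"


section \<open>Smooth manifolds and smooth maps\<close>

text \<open>A chart is a pair of its domain and its coordinate map into the model space \<open>'e\<close>;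
  the values of the coordinate map outside the domain are irrelevant.\<close>

type_synonym ('a, 'e) chart = "'a set \<times> ('a \<Rightarrow> 'e)"

record ('a, 'e) mfd =
  mtop :: "'a topology"
  atlas :: "('a, 'e) chart set"

definition chart_inv :: "('a, 'e) chart \<Rightarrow> 'e \<Rightarrow> 'a" where
  "chart_inv c = inv_into (fst c) (snd c)"

definition smooth_manifold :: "('a, 'e::euclidean_space) mfd \<Rightarrow> bool" where
  "smooth_manifold M \<longleftrightarrow>
     Hausdorff_space (mtop M) \<and> second_countable (mtop M) \<and>
     (\<Union>c\<in>atlas M. fst c) = topspace (mtop M) \<and>
     (\<forall>c\<in>atlas M. openin (mtop M) (fst c) \<and> open (snd c ` fst c) \<and>
        homeomorphic_map (subtopology (mtop M) (fst c)) (top_of_set (snd c ` fst c)) (snd c)) \<and>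
     (\<forall>c\<in>atlas M. \<forall>d\<in>atlas M.
        smooth_on (snd c ` (fst c \<inter> fst d)) (snd d \<circ> chart_inv c))"

text \<open>There is no boundary, because chart images are open in the model space.\<close>

definition closed_manifold :: "('a, 'e::euclidean_space) mfd \<Rightarrow> bool" where
  "closed_manifold M \<longleftrightarrow> smooth_manifold M \<and> compact_space (mtop M)"

definition smooth_map ::
    "('a, 'e::euclidean_space) mfd \<Rightarrow> ('b, 'f::euclidean_space) mfd \<Rightarrow> 'a set \<Rightarrow> ('a \<Rightarrow> 'b) \<Rightarrow> bool" where
  "smooth_map M M' S f \<longleftrightarrow>
     openin (mtop M) S \<and> continuous_map (subtopology (mtop M) S) (mtop M') f \<and>
     (\<forall>c\<in>atlas M. \<forall>d\<in>atlas M'.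
        smooth_on (snd c ` {p \<in> S \<inter> fst c. f p \<in> fst d}) (snd d \<circ> f \<circ> chart_inv c))"

definition smooth_fun :: "('a, 'e::euclidean_space) mfd \<Rightarrow> ('a \<Rightarrow> real) \<Rightarrow> bool" where
  "smooth_fun M u \<longleftrightarrow> (\<forall>c\<in>atlas M. smooth_on (snd c ` fst c) (u \<circ> chart_inv c))"

definition mfd_prod :: "('a, 'e) mfd \<Rightarrow> ('b, 'f) mfd \<Rightarrow> ('a \<times> 'b, 'e \<times> 'f) mfd" where
  "mfd_prod M M' = \<lparr>mtop = prod_topology (mtop M) (mtop M'),
     atlas = {(fst c \<times> fst d, map_prod (snd c) (snd d)) | c d. c \<in> atlas M \<and> d \<in> atlas M'}\<rparr>"

text \<open>The unit circle in the complex plane. The chart with parameter \<open>a\<close> omits the point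
  \<open>- cis a\<close> and takes values in the open interval from \<open>a - pi\<close> to \<open>a + pi\<close>.\<close>

definition circle :: "(complex, real) mfd" where
  "circle = \<lparr>mtop = top_of_set (sphere 0 1),
     atlas = {(sphere 0 1 - {- cis a}, \<lambda>z. a + Arg (z * cis (- a))) | a. True}\<rparr>"

text \<open>The differential of \<open>f\<close> at \<open>p\<close>, expressed in the charts \<open>c\<close> (source) and \<open>d\<close> (target).\<close>

definition tangent_map ::
    "('a, 'e::euclidean_space) chart \<Rightarrow> ('b, 'f::euclidean_space) chart \<Rightarrow> ('a \<Rightarrow> 'b) \<Rightarrow> 'a \<Rightarrow> 'e \<Rightarrow> 'f" where
  "tangent_map c d f p = frechet_derivative (snd d \<circ> f \<circ> chart_inv c) (at (snd c p))"

definition dir_deriv :: "('a, 'e::euclidean_space) chart \<Rightarrow> 'e \<Rightarrow> ('a \<Rightarrow> real) \<Rightarrow> 'a \<Rightarrow> real" where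
  "dir_deriv c v u p = frechet_derivative (u \<circ> chart_inv c) (at (snd c p)) v"


section \<open>Covariant tensor fields and differential forms\<close>

text \<open>A covariant tensor field is given by its local representation in every chart:
  \<open>\<omega> c p v w\<close> is the value at the point \<open>p\<close> on the tangent vectors whose coordinate vectors in
  the chart \<open>c\<close> are \<open>v\<close> and \<open>w\<close>. Only charts of the atlas and points of their domains matter.
  The transformation law between charts is invariance under pullback along the identity.\<close>

type_synonym ('a, 'e) cov1 = "('a, 'e) chart \<Rightarrow> 'a \<Rightarrow> 'e \<Rightarrow> real"
type_synonym ('a, 'e) cov2 = "('a, 'e) chart \<Rightarrow> 'a \<Rightarrow> 'e \<Rightarrow> 'e \<Rightarrow> real"

text \<open>\<open>is_pullback1 M M' f \<beta> \<alpha>\<close> says that \<open>\<alpha>\<close> on \<open>M\<close> is the pullback of \<open>\<beta>\<close> on \<open>M'\<close> along \<open>f\<close>.\<close>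

definition is_pullback1 :: "('a, 'e::euclidean_space) mfd \<Rightarrow> ('b, 'f::euclidean_space) mfd \<Rightarrow>
    ('a \<Rightarrow> 'b) \<Rightarrow> ('b, 'f) cov1 \<Rightarrow> ('a, 'e) cov1 \<Rightarrow> bool" where
  "is_pullback1 M M' f \<beta> \<alpha> \<longleftrightarrow>
     (\<forall>c\<in>atlas M. \<forall>d\<in>atlas M'. \<forall>p\<in>fst c. f p \<in> fst d \<longrightarrow>
        (\<forall>v. \<alpha> c p v = \<beta> d (f p) (tangent_map c d f p v)))"

definition is_pullback2 :: "('a, 'e::euclidean_space) mfd \<Rightarrow> ('b, 'f::euclidean_space) mfd \<Rightarrow>
    ('a \<Rightarrow> 'b) \<Rightarrow> ('b, 'f) cov2 \<Rightarrow> ('a, 'e) cov2 \<Rightarrow> bool" where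
  "is_pullback2 M M' f \<beta> \<alpha> \<longleftrightarrow>
     (\<forall>c\<in>atlas M. \<forall>d\<in>atlas M'. \<forall>p\<in>fst c. f p \<in> fst d \<longrightarrow>
        (\<forall>v w. \<alpha> c p v w = \<beta> d (f p) (tangent_map c d f p v) (tangent_map c d f p w)))"

definition one_form :: "('a, 'e::euclidean_space) mfd \<Rightarrow> ('a, 'e) cov1 \<Rightarrow> bool" where
  "one_form M \<alpha> \<longleftrightarrow>
     (\<forall>c\<in>atlas M. (\<forall>p\<in>fst c. linear (\<alpha> c p)) \<and>
        (\<forall>v. smooth_on (snd c ` fst c) ((\<lambda>p. \<alpha> c p v) \<circ> chart_inv c))) \<and>
     is_pullback1 M M (\<lambda>p. p) \<alpha> \<alpha>"

definition tensor2 :: "('a, 'e::euclidean_space) mfd \<Rightarrow> ('a, 'e) cov2 \<Rightarrow> bool" where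
  "tensor2 M \<omega> \<longleftrightarrow>
     (\<forall>c\<in>atlas M. (\<forall>p\<in>fst c. bilinear (\<omega> c p)) \<and>
        (\<forall>v w. smooth_on (snd c ` fst c) ((\<lambda>p. \<omega> c p v w) \<circ> chart_inv c))) \<and>
     is_pullback2 M M (\<lambda>p. p) \<omega> \<omega>"

definition two_form :: "('a, 'e::euclidean_space) mfd \<Rightarrow> ('a, 'e) cov2 \<Rightarrow> bool" where
  "two_form M \<omega> \<longleftrightarrow> tensor2 M \<omega> \<and>
     (\<forall>c\<in>atlas M. \<forall>p\<in>fst c. \<forall>v w. \<omega> c p v w = - \<omega> c p w v)"

definition riemannian_metric :: "('a, 'e::euclidean_space) mfd \<Rightarrow> ('a, 'e) cov2 \<Rightarrow> bool" where
  "riemannian_metric M g \<longleftrightarrow> tensor2 M g \<and>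
     (\<forall>c\<in>atlas M. \<forall>p\<in>fst c. (\<forall>v w. g c p v w = g c p w v) \<and> (\<forall>v. v \<noteq> 0 \<longrightarrow> g c p v v > 0))"

text \<open>Exterior derivatives in coordinates, evaluated on constant coordinate vector fields.\<close>

definition ext_d1 :: "('a, 'e::euclidean_space) cov1 \<Rightarrow> ('a, 'e) cov2" where
  "ext_d1 \<alpha> c p v w =
     dir_deriv c v (\<lambda>q. \<alpha> c q w) p - dir_deriv c w (\<lambda>q. \<alpha> c q v) p"

definition ext_d2 :: "('a, 'e::euclidean_space) cov2 \<Rightarrow> ('a, 'e) chart \<Rightarrow> 'a \<Rightarrow> 'e \<Rightarrow> 'e \<Rightarrow> 'e \<Rightarrow> real" where
  "ext_d2 \<omega> c p u v w =
     dir_deriv c u (\<lambda>q. \<omega> c q v w) p + dir_deriv c v (\<lambda>q. \<omega> c q w u) p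
       + dir_deriv c w (\<lambda>q. \<omega> c q u v) p"

definition closed_2form :: "('a, 'e::euclidean_space) mfd \<Rightarrow> ('a, 'e) cov2 \<Rightarrow> bool" where
  "closed_2form M \<omega> \<longleftrightarrow> two_form M \<omega> \<and>
     (\<forall>c\<in>atlas M. \<forall>p\<in>fst c. \<forall>u v w. ext_d2 \<omega> c p u v w = 0)"

text \<open>The de Rham class of a closed 2-form, as a coset of the exact 2-forms.\<close>

definition de_rham_class2 :: "('a, 'e::euclidean_space) mfd \<Rightarrow> ('a, 'e) cov2 \<Rightarrow> ('a, 'e) cov2 set" where
  "de_rham_class2 M \<omega> = {\<omega>'. closed_2form M \<omega>' \<and>
     (\<exists>\<alpha>. one_form M \<alpha> \<and>
        (\<forall>c\<in>atlas M. \<forall>p\<in>fst c. \<forall>v w. \<omega>' c p v w - \<omega> c p v w = ext_d1 \<alpha> c p v w))}"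


section \<open>Principal circle bundles and connections\<close>

text \<open>A smooth action of the circle on \<open>P\<close> together with equivariant local trivializations
  \<open>p \<mapsto> (\<pi> p, \<tau> p)\<close>; freeness, and transitivity on the fibres, are consequences.\<close>

definition principal_circle_bundle :: "('p, 'e::euclidean_space) mfd \<Rightarrow> ('a, 'f::euclidean_space) mfd \<Rightarrow>
    ('p \<Rightarrow> 'a) \<Rightarrow> (complex \<Rightarrow> 'p \<Rightarrow> 'p) \<Rightarrow> bool" where
  "principal_circle_bundle P N \<pi> act \<longleftrightarrow>
     smooth_manifold P \<and> smooth_manifold N \<and> smooth_map P N (topspace (mtop P)) \<pi> \<and>
     smooth_map (mfd_prod circle P) P (sphere 0 1 \<times> topspace (mtop P)) (\<lambda>(z, p). act z p) \<and>
     (\<forall>p\<in>topspace (mtop P). act 1 p = p \<and>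
        (\<forall>z\<in>sphere 0 1. \<pi> (act z p) = \<pi> p \<and>
           (\<forall>w\<in>sphere 0 1. act z (act w p) = act (z * w) p))) \<and>
     (\<forall>x\<in>topspace (mtop N). \<exists>U \<tau>. let V = {p \<in> topspace (mtop P). \<pi> p \<in> U};
          \<Phi> = (\<lambda>p. (\<pi> p, \<tau> p)) in
        openin (mtop N) U \<and> x \<in> U \<and> bij_betw \<Phi> V (U \<times> sphere 0 1) \<and>
        smooth_map P (mfd_prod N circle) V \<Phi> \<and>
        smooth_map (mfd_prod N circle) P (U \<times> sphere 0 1) (inv_into V \<Phi>) \<and>
        (\<forall>p\<in>V. \<forall>z\<in>sphere 0 1. \<tau> (act z p) = z * \<tau> p))"

text \<open>The fundamental vector field of the action, generated by \<open>cis t\<close>, in the chart \<open>c\<close>.\<close>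

definition fund_field :: "(complex \<Rightarrow> 'p \<Rightarrow> 'p) \<Rightarrow> ('p, 'e::euclidean_space) chart \<Rightarrow> 'p \<Rightarrow> 'e" where
  "fund_field act c p = vector_derivative (\<lambda>t. snd c (act (cis t) p)) (at 0)"

text \<open>The Lie algebra of the circle is identified with the reals, so that a connection form is a
  real-valued 1-form taking the value 1 on the fundamental vector field.\<close>

definition connection_form ::
    "('p, 'e::euclidean_space) mfd \<Rightarrow> (complex \<Rightarrow> 'p \<Rightarrow> 'p) \<Rightarrow> ('p, 'e) cov1 \<Rightarrow> bool" where
  "connection_form P act \<eta> \<longleftrightarrow> one_form P \<eta> \<and>
     (\<forall>z\<in>sphere 0 1. is_pullback1 P P (act z) \<eta> \<eta>) \<and>
     (\<forall>c\<in>atlas P. \<forall>p\<in>fst c. \<eta> c p (fund_field act c p) = 1)"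

text \<open>The 2-form on the base that is identified with \<open>d\<eta>\<close>.\<close>

definition curvature_form :: "('p, 'e::euclidean_space) mfd \<Rightarrow> ('a, 'f::euclidean_space) mfd \<Rightarrow>
    ('p \<Rightarrow> 'a) \<Rightarrow> ('p, 'e) cov1 \<Rightarrow> ('a, 'f) cov2 \<Rightarrow> bool" where
  "curvature_form P N \<pi> \<eta> F \<longleftrightarrow> two_form N F \<and> is_pullback2 P N \<pi> F (ext_d1 \<eta>)"


section \<open>Riemannian geometry in local coordinates\<close>

definition pd :: "('a, real^'n) chart \<Rightarrow> 'n \<Rightarrow> ('a \<Rightarrow> real) \<Rightarrow> 'a \<Rightarrow> real" where
  "pd c i u p = dir_deriv c (axis i 1) u p"

definition comp2 :: "('a, real^'n) cov2 \<Rightarrow> ('a, real^'n) chart \<Rightarrow> 'n \<Rightarrow> 'n \<Rightarrow> 'a \<Rightarrow> real" where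
  "comp2 T c i j p = T c p (axis i 1) (axis j 1)"

definition gmat :: "('a, real^'n) cov2 \<Rightarrow> ('a, real^'n) chart \<Rightarrow> 'a \<Rightarrow> real^'n^'n" where
  "gmat g c p = (\<chi> i j. comp2 g c i j p)"

definition ginv :: "('a, real^'n) cov2 \<Rightarrow> ('a, real^'n) chart \<Rightarrow> 'n \<Rightarrow> 'n \<Rightarrow> 'a \<Rightarrow> real" where
  "ginv g c i j p = matrix_inv (gmat g c p) $ i $ j"

definition tr_g :: "('a, real^'n) cov2 \<Rightarrow> ('a, real^'n) chart \<Rightarrow> ('n \<Rightarrow> 'n \<Rightarrow> 'a \<Rightarrow> real) \<Rightarrow> 'a \<Rightarrow> real" where
  "tr_g g c T p = (\<Sum>i\<in>UNIV. \<Sum>j\<in>UNIV. ginv g c i j p * T i j p)"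

text \<open>\<open>christoffel g c k i j\<close> has \<open>k\<close> as its upper index.\<close>

definition christoffel :: "('a, real^'n) cov2 \<Rightarrow> ('a, real^'n) chart \<Rightarrow> 'n \<Rightarrow> 'n \<Rightarrow> 'n \<Rightarrow> 'a \<Rightarrow> real" where
  "christoffel g c k i j p = 1/2 * (\<Sum>l\<in>UNIV. ginv g c k l p *
     (pd c i (comp2 g c j l) p + pd c j (comp2 g c i l) p - pd c l (comp2 g c i j) p))"

text \<open>\<open>riem g c l k i j\<close> is the component \<open>l\<close> of \<open>R(\<partial>\<^sub>i, \<partial>\<^sub>j) \<partial>\<^sub>k\<close>, with
  \<open>R(X, Y) = [\<nabla>\<^sub>X, \<nabla>\<^sub>Y] - \<nabla>\<^bsub>[X, Y]\<^esub>\<close>; round spheres have positive Ricci curvature.\<close>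

definition riem :: "('a, real^'n) cov2 \<Rightarrow> ('a, real^'n) chart \<Rightarrow> 'n \<Rightarrow> 'n \<Rightarrow> 'n \<Rightarrow> 'n \<Rightarrow> 'a \<Rightarrow> real" where
  "riem g c l k i j p =
     pd c i (christoffel g c l j k) p - pd c j (christoffel g c l i k) p
     + (\<Sum>m\<in>UNIV. christoffel g c l i m p * christoffel g c m j k p
                 - christoffel g c l j m p * christoffel g c m i k p)"

definition ricci :: "('a, real^'n) cov2 \<Rightarrow> ('a, real^'n) chart \<Rightarrow> 'n \<Rightarrow> 'n \<Rightarrow> 'a \<Rightarrow> real" where
  "ricci g c j k p = (\<Sum>i\<in>UNIV. riem g c i k i j p)"

definition scal :: "('a, real^'n) cov2 \<Rightarrow> ('a, real^'n) chart \<Rightarrow> 'a \<Rightarrow> real" where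
  "scal g c p = tr_g g c (ricci g c) p"

definition hess :: "('a, real^'n) cov2 \<Rightarrow> ('a, real^'n) chart \<Rightarrow> ('a \<Rightarrow> real) \<Rightarrow> 'n \<Rightarrow> 'n \<Rightarrow> 'a \<Rightarrow> real" where
  "hess g c u i j p =
     pd c i (pd c j u) p - (\<Sum>k\<in>UNIV. christoffel g c k i j p * pd c k u p)"

definition laplacian :: "('a, real^'n) cov2 \<Rightarrow> ('a, real^'n) chart \<Rightarrow> ('a \<Rightarrow> real) \<Rightarrow> 'a \<Rightarrow> real" where
  "laplacian g c u p = tr_g g c (hess g c u) p"

text \<open>\<open>j_op\<close> is \<open>F\<^sub>i\<^sub>k F\<^sub>j\<^sup>k\<close>; \<open>normsq\<close> is the full contraction \<open>F\<^sub>i\<^sub>j F\<^sup>i\<^sup>j\<close>,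
  without a factor 1/2.\<close>

definition j_op :: "('a, real^'n) cov2 \<Rightarrow> ('a, real^'n) cov2 \<Rightarrow> ('a, real^'n) chart \<Rightarrow>
    'n \<Rightarrow> 'n \<Rightarrow> 'a \<Rightarrow> real" where
  "j_op g F c i j p =
     (\<Sum>k\<in>UNIV. \<Sum>l\<in>UNIV. ginv g c k l p * comp2 F c i k p * comp2 F c j l p)"

definition normsq :: "('a, real^'n) cov2 \<Rightarrow> ('a, real^'n) cov2 \<Rightarrow> ('a, real^'n) chart \<Rightarrow> 'a \<Rightarrow> real" where
  "normsq g F c p =
     (\<Sum>i\<in>UNIV. \<Sum>j\<in>UNIV. \<Sum>k\<in>UNIV. \<Sum>l\<in>UNIV.
        ginv g c i k p * ginv g c j l p * comp2 F c i j p * comp2 F c k l p)"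

text \<open>\<open>cov_deriv2 g \<omega> c k i j\<close> is \<open>(\<nabla>\<^sub>k \<omega>)\<^sub>i\<^sub>j\<close>.\<close>

definition cov_deriv2 :: "('a, real^'n) cov2 \<Rightarrow> ('a, real^'n) cov2 \<Rightarrow> ('a, real^'n) chart \<Rightarrow>
    'n \<Rightarrow> 'n \<Rightarrow> 'n \<Rightarrow> 'a \<Rightarrow> real" where
  "cov_deriv2 g \<omega> c k i j p = pd c k (comp2 \<omega> c i j) p
     - (\<Sum>l\<in>UNIV. christoffel g c l k i p * comp2 \<omega> c l j p
                  + christoffel g c l k j p * comp2 \<omega> c i l p)"

text \<open>The codifferential \<open>d\<^sup>*\<close> of a 2-form, \<open>(d\<^sup>*\<omega>)\<^sub>j = - \<nabla>\<^sup>i \<omega>\<^sub>i\<^sub>j\<close>; with this sign it is the formal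
  adjoint of \<open>d\<close> with respect to the inner products of forms.\<close>

definition codiff2 :: "('a, real^'n) cov2 \<Rightarrow> ('a, real^'n) cov2 \<Rightarrow> ('a, real^'n) cov1" where
  "codiff2 g \<omega> c p v =
     - (\<Sum>j\<in>UNIV. (\<Sum>k\<in>UNIV. \<Sum>i\<in>UNIV. ginv g c k i p * cov_deriv2 g \<omega> c k i j p) * v $ j)"

text \<open>The volume form in the chart \<open>c\<close>, \<open>sqrt (det (g\<^sub>i\<^sub>j)) dx\<^sup>1 \<and> \<dots> \<and> dx\<^sup>n\<close>, evaluated on vectors
  \<open>v i\<close>. The orientation is the one given by \<open>c\<close>; the opposite one only changes the sign.\<close>

definition vol_form :: "('a, real^'n) cov2 \<Rightarrow> ('a, real^'n) chart \<Rightarrow> 'a \<Rightarrow> ('n \<Rightarrow> real^'n) \<Rightarrow> real" where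
  "vol_form g c p v = sqrt (det (gmat g c p)) * det (\<chi> i j. v j $ i)"


section \<open>The flow\<close>

definition scale2 :: "('a \<Rightarrow> real) \<Rightarrow> ('a, 'e) cov2 \<Rightarrow> ('a, 'e) cov2" where
  "scale2 u \<omega> c p v w = u p * \<omega> c p v w"

definition hinv :: "('a \<Rightarrow> real) \<Rightarrow> 'a \<Rightarrow> real" where
  "hinv h p = h p powr (-1)"

definition hroot :: "('a \<Rightarrow> real) \<Rightarrow> 'a \<Rightarrow> real" where
  "hroot h p = h p powr (1/2)"

definition rhs_g :: "('a, real^'n) cov2 \<Rightarrow> ('a \<Rightarrow> real) \<Rightarrow> ('a, real^'n) cov2 \<Rightarrow> ('a, real^'n) chart \<Rightarrow>
    'n \<Rightarrow> 'n \<Rightarrow> 'a \<Rightarrow> real" where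
  "rhs_g g h F c i j p =
     1/2 * hroot h p * (ricci g c i j p - 1/2 * scal g c p * comp2 g c i j p)
     - 1/2 * (hess g c (hroot h) i j p - laplacian g c (hroot h) p * comp2 g c i j p)
     - 1/8 * hinv h p * (j_op g F c i j p - 1/2 * normsq g F c p * comp2 g c i j p)"

definition rhs_h :: "('a, real^'n) cov2 \<Rightarrow> ('a \<Rightarrow> real) \<Rightarrow> ('a, real^'n) cov2 \<Rightarrow> ('a, real^'n) chart \<Rightarrow>
    'a \<Rightarrow> real" where
  "rhs_h g h F c p =
     - 1/4 * h p powr (-1/2) * scal g c p - 1/8 * h p powr (-2) * normsq g F c p"

definition rhs_eta :: "('a, real^'n) cov2 \<Rightarrow> ('a \<Rightarrow> real) \<Rightarrow> ('a, real^'n) cov2 \<Rightarrow> ('a, real^'n) cov1" where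
  "rhs_eta g h F c p v = 1/4 * codiff2 g (scale2 (hinv h) F) c p v"

definition flow_data :: "('p, 'e::euclidean_space) mfd \<Rightarrow> ('a, real^'n) mfd \<Rightarrow> ('p \<Rightarrow> 'a) \<Rightarrow>
    (complex \<Rightarrow> 'p \<Rightarrow> 'p) \<Rightarrow> ('a, real^'n) cov2 \<Rightarrow> ('a \<Rightarrow> real) \<Rightarrow> ('p, 'e) cov1 \<Rightarrow>
    ('a, real^'n) cov2 \<Rightarrow> bool" where
  "flow_data P N \<pi> act g h \<eta> F \<longleftrightarrow>
     riemannian_metric N g \<and> smooth_fun N h \<and> (\<forall>p\<in>topspace (mtop N). h p > 0) \<and>
     connection_form P act \<eta> \<and> curvature_form P N \<pi> \<eta> F"

text \<open>The time derivative of \<open>\<eta>\<close> lives on the total space; its identification with a 1-form on the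
  base is by pullback along \<open>\<pi>\<close>. Derivatives at endpoints contained in \<open>I\<close> are one-sided.\<close>

definition flow_solution :: "('p, 'e::euclidean_space) mfd \<Rightarrow> ('a, real^'n) mfd \<Rightarrow> ('p \<Rightarrow> 'a) \<Rightarrow>
    (complex \<Rightarrow> 'p \<Rightarrow> 'p) \<Rightarrow> real set \<Rightarrow> (real \<Rightarrow> ('a, real^'n) cov2) \<Rightarrow> (real \<Rightarrow> 'a \<Rightarrow> real) \<Rightarrow>
    (real \<Rightarrow> ('p, 'e) cov1) \<Rightarrow> (real \<Rightarrow> ('a, real^'n) cov2) \<Rightarrow> bool" where
  "flow_solution P N \<pi> act I g h \<eta> F \<longleftrightarrow>
     (\<forall>t\<in>I. flow_data P N \<pi> act (g t) (h t) (\<eta> t) (F t) \<and>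
       (\<forall>c\<in>atlas N. \<forall>p\<in>fst c.
          (\<forall>i j. ((\<lambda>s. comp2 (g s) c i j p) has_real_derivative
                    rhs_g (g t) (h t) (F t) c i j p) (at t within I)) \<and>
          ((\<lambda>s. h s p) has_real_derivative rhs_h (g t) (h t) (F t) c p) (at t within I)) \<and>
       (\<exists>\<eta>'. (\<forall>c\<in>atlas P. \<forall>p\<in>fst c. \<forall>v.
                ((\<lambda>s. \<eta> s c p v) has_real_derivative \<eta>' c p v) (at t within I)) \<and>
             is_pullback1 P N \<pi> (rhs_eta (g t) (h t) (F t)) \<eta>'))"

text \<open>A triple on the same bundle at which all right-hand sides vanish. No mode of convergence of a
  solution to the triple is part of the definition, so limits in any topology are covered.\<close>

definition stationary_limit :: "('p, 'e::euclidean_space) mfd \<Rightarrow> ('a, real^'n) mfd \<Rightarrow> ('p \<Rightarrow> 'a) \<Rightarrow>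
    (complex \<Rightarrow> 'p \<Rightarrow> 'p) \<Rightarrow> ('a, real^'n) cov2 \<Rightarrow> ('a \<Rightarrow> real) \<Rightarrow> ('p, 'e) cov1 \<Rightarrow>
    ('a, real^'n) cov2 \<Rightarrow> bool" where
  "stationary_limit P N \<pi> act g h \<eta> F \<longleftrightarrow> flow_data P N \<pi> act g h \<eta> F \<and>
     (\<forall>c\<in>atlas N. \<forall>p\<in>fst c.
        (\<forall>i j. rhs_g g h F c i j p = 0) \<and> rhs_h g h F c p = 0 \<and> (\<forall>v. rhs_eta g h F c p v = 0))"

end

(*
  (1) The difference of two connection forms is invariant and vanishes on the fundamental field,
  hence it is the pullback of a 1-form on N, whose exterior derivative is the difference of the
  curvatures; so all connections on the bundle have the same curvature class. Everything is
  evaluated along local sections s of the bundle, where F = d (s^* eta), which also gives dF = 0.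
  (2) A zero of the equation for h determines the scalar curvature, and |F|^2 >= 0 because the
  inverse metric is a sum of squares.
  (3) By Jacobi's formula the logarithmic derivative of sqrt (det g) is half the g-trace of the time
  derivative of g; in dimension 6 tracing the equation for g gives the stated factors.
*)
theory Submission
  imports Defs
begin

subsection \<open>Differentiability of finite order\<close>

text \<open>The obstacle is that a tensor is only a family of chart representations, with no
  intrinsic tangent space behind it. A form on the base must therefore be built chart by chart, and
  its linearity, smoothness, transformation law and exterior derivative have to be checked in
  coordinates. Near a given point a local section exhibits the descended form as a pullback along a
  smooth map; this settles linearity and smoothness, and its exterior derivative follows once d is
  known to commute with pullback. That fact rests on the symmetry of second derivatives, which has
  to be extracted from \<open>Ck_on\<close>, where only iterated directional derivatives and their
  continuity are available. The transformation law comes instead from lifting a base vector to the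
  total space, where no base chart has been chosen. Local trivializations take values in the product
  of N with the circle. Charts of the circle and of products are needed to see that a vector killed
  by the differential of the projection is a multiple of the fundamental field, which is what makes
  a horizontal form independent of the lift.\<close>

lemma Ck_on_cong:
  assumes "open S" "\<And>x. x \<in> S \<Longrightarrow> f x = g x" "Ck_on k S f"
  shows "Ck_on k S g"
  using assms(2,3)
proof (induction k arbitrary: f g)
  case 0
  then show ?case using continuous_on_cong by (metis Ck_on.simps(1))
next
  case (Suc k)
  have D: "(g has_derivative frechet_derivative f (at x)) (at x)" if "x \<in> S" for x
  proof (rule has_derivative_transform_within_open[OF _ assms(1) that])
    show "(f has_derivative frechet_derivative f (at x)) (at x)"
      using Suc.prems that by (simp add: frechet_derivative_works)
  qed (use Suc.prems in auto)
  have "Ck_on k S (\<lambda>x. frechet_derivative g (at x) v)" for v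
  proof (rule Suc.IH)
    show "frechet_derivative f (at x) v = frechet_derivative g (at x) v" if "x \<in> S" for x
      using frechet_derivative_at[OF D[OF that]] by simp
  qed (use Suc.prems in simp)
  with D show ?case by (auto simp: differentiable_def)
qed

text \<open>Introduction rule for the inductions on the order: by uniqueness of derivatives, an
  explicit derivative can stand in for the chosen \<open>frechet_derivative\<close>.\<close>

lemma Ck_on_Suc:
  assumes "open S" "\<And>x. x \<in> S \<Longrightarrow> (f has_derivative f' x) (at x)" "\<And>v. Ck_on k S (\<lambda>x. f' x v)"
  shows "Ck_on (Suc k) S f"
proof -
  have "frechet_derivative f (at x) = f' x" if "x \<in> S" for x
    using assms(2)[OF that] frechet_derivative_at by metis
  then have "Ck_on k S (\<lambda>x. frechet_derivative f (at x) v)" for v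
    by (intro Ck_on_cong[OF assms(1) _ assms(3)[of v]]) auto
  then show ?thesis using assms(2) by (auto simp: differentiable_def)
qed

lemma Ck_on_subset: "Ck_on k S f \<Longrightarrow> T \<subseteq> S \<Longrightarrow> Ck_on k T f"
  by (induction k arbitrary: f) (auto intro: continuous_on_subset)

text \<open>Regularity is a condition near each point. This allows the intermediate chart, or the
  local section, to vary with the point in later smoothness proofs.\<close>

lemma Ck_on_local:
  assumes "\<And>x. x \<in> S \<Longrightarrow> \<exists>T. open T \<and> x \<in> T \<and> Ck_on k T f"
  shows "Ck_on k S f"
  using assms
proof (induction k arbitrary: f)
  case 0
  have "isCont f x" if "x \<in> S" for x
    using 0[OF that] by (auto simp: continuous_on_eq_continuous_at)
  then show ?case by (simp add: continuous_at_imp_continuous_on)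
next
  case (Suc k)
  show ?case
    using Suc.prems by (fastforce intro!: Suc.IH)
qed

lemma Ck_on_Suc_imp: "Ck_on (Suc k) S f \<Longrightarrow> Ck_on k S f"
proof (induction k arbitrary: f)
  case 0
  then show ?case
    by (auto intro!: continuous_at_imp_continuous_on differentiable_imp_continuous_within)
qed auto

lemma Ck_on_deriv:
  assumes "Ck_on (Suc k) S f" "x \<in> S"
  shows "(f has_derivative frechet_derivative f (at x)) (at x)"
  using assms by (simp add: frechet_derivative_works)

lemma Ck_on_const: "open S \<Longrightarrow> Ck_on k S (\<lambda>x. c)"
  by (induction k arbitrary: c) (auto intro!: Ck_on_Suc derivative_eq_intros)

lemma Ck_on_bounded_linear:
  fixes f :: "'a::euclidean_space \<Rightarrow> 'b::euclidean_space"
  assumes L: "bounded_linear L" and "open S" "Ck_on k S f"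
  shows "Ck_on k S (\<lambda>x. L (f x))"
  using assms(3)
proof (induction k arbitrary: f)
  case 0
  then show ?case by (simp add: bounded_linear.continuous_on[OF L])
next
  case (Suc k)
  show ?case
    by (rule Ck_on_Suc[where f' = "\<lambda>x v. L (frechet_derivative f (at x) v)"])
      (use Suc bounded_linear.has_derivative[OF L Ck_on_deriv[OF Suc.prems]] \<open>open S\<close> in auto)
qed

lemma Ck_on_add:
  assumes "open S" "Ck_on k S f" "Ck_on k S g"
  shows "Ck_on k S (\<lambda>x. f x + g x)"
  using assms(2,3)
proof (induction k arbitrary: f g)
  case 0
  then show ?case by (auto intro: continuous_intros)
next
  case (Suc k)
  show ?case
    by (rule Ck_on_Suc[OF \<open>open S\<close>
          has_derivative_add[OF Ck_on_deriv[OF Suc.prems(1)] Ck_on_deriv[OF Suc.prems(2)]]])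
      (use Suc assms(1) in auto)
qed

text \<open>The Leibniz rule brings back \<open>f\<close> and \<open>g\<close> undifferentiated, so
  the induction step also uses that order \<open>Suc k\<close> implies order
  \<open>k\<close>.\<close>

lemma Ck_on_bilinear:
  assumes B: "bounded_bilinear B" and "open S" "Ck_on k S f" "Ck_on k S g"
  shows "Ck_on k S (\<lambda>x. B (f x) (g x))"
  using assms(3,4)
proof (induction k arbitrary: f g)
  case 0
  then show ?case by (auto intro: bounded_bilinear.continuous_on[OF B])
next
  case (Suc k)
  show ?case
    by (rule Ck_on_Suc[OF \<open>open S\<close> bounded_bilinear.FDERIV[OF B
             Ck_on_deriv[OF Suc.prems(1)] Ck_on_deriv[OF Suc.prems(2)]]])
      (use Suc Ck_on_Suc_imp[OF Suc.prems(1)] Ck_on_Suc_imp[OF Suc.prems(2)] in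
        \<open>auto intro!: Ck_on_add \<open>open S\<close>\<close>)
qed

lemma Ck_on_sum:
  assumes "open S" "finite J" "\<And>i. i \<in> J \<Longrightarrow> Ck_on k S (f i)"
  shows "Ck_on k S (\<lambda>x. \<Sum>i\<in>J. f i x)"
  using assms(2,3) by (induction J) (auto intro!: Ck_on_add Ck_on_const assms(1))

text \<open>Separates the direction from the linear map. Regularity is only known for derivatives in
  a fixed direction, so a direction that varies with the point is expanded in the basis.\<close>

lemma linear_frechet_Basis:
  assumes "linear L"
  shows "L v = (\<Sum>b\<in>Basis. (v \<bullet> b) *\<^sub>R L b)"
proof -
  have "L v = L (\<Sum>b\<in>Basis. (v \<bullet> b) *\<^sub>R b)" by (simp add: euclidean_representation)
  then show ?thesis using assms by (simp add: linear_sum linear_cmul)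
qed

text \<open>In the chain rule the derivative of \<open>g\<close> is applied to a direction depending
  on \<open>x\<close>. After expansion in the basis only products of coefficients with derivatives
  of \<open>g\<close> in fixed directions remain.\<close>

lemma Ck_on_compose:
  assumes "open S" "open T" "f ` S \<subseteq> T" "Ck_on k S f" "Ck_on k T g"
  shows "Ck_on k S (\<lambda>x. g (f x))"
  using assms(3,4,5)
proof (induction k arbitrary: f g)
  case 0
  then show ?case
    using continuous_on_compose2[of T g S f] by simp
next
  case (Suc k)
  let ?f' = "\<lambda>x. frechet_derivative f (at x)" and ?g' = "\<lambda>y. frechet_derivative g (at y)"
  have T: "f x \<in> T" if "x \<in> S" for x using Suc.prems(1) that by blast
  have "((\<lambda>x. g (f x)) has_derivative (\<lambda>v. \<Sum>b\<in>Basis. (?f' x v \<bullet> b) *\<^sub>R ?g' (f x) b)) (at x)"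
    if "x \<in> S" for x
  proof -
    have *: "(g has_derivative ?g' (f x)) (at (f x))"
      by (rule Ck_on_deriv[OF Suc.prems(3) T[OF that]])
    have eq: "?g' (f x) (?f' x v) = (\<Sum>b\<in>Basis. (?f' x v \<bullet> b) *\<^sub>R ?g' (f x) b)" for v
      by (rule linear_frechet_Basis[OF has_derivative_linear[OF *]])
    show ?thesis
      using has_derivative_compose[OF Ck_on_deriv[OF Suc.prems(2) that] *] unfolding eq .
  qed
  then show ?case
  proof (rule Ck_on_Suc[OF assms(1)])
    fix v
    \<comment> \<open>For fixed \<open>b\<close> this is again a composition, of a map of order
      \<open>k\<close> with \<open>f\<close>, so the induction hypothesis covers it.\<close>
    have "Ck_on k S (\<lambda>x. ?g' (f x) b)" for b
      by (intro Suc.IH[where g = "\<lambda>y. ?g' y b"] Suc.prems(1) Ck_on_Suc_imp[OF Suc.prems(2)]) (use Suc.prems in simp)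
    moreover have "Ck_on k S (\<lambda>x. ?f' x v \<bullet> b)" for b
      using Suc.prems by (intro Ck_on_bounded_linear[OF bounded_linear_inner_left assms(1)]) simp
    ultimately show "Ck_on k S (\<lambda>x. \<Sum>b\<in>Basis. (?f' x v \<bullet> b) *\<^sub>R ?g' (f x) b)"
      by (intro Ck_on_sum assms(1) Ck_on_bilinear[OF bounded_bilinear_scaleR]) auto
  qed
qed

lemma Ck_on_Pair:
  assumes "open S" "Ck_on k S f" "Ck_on k S g"
  shows "Ck_on k S (\<lambda>x. (f x, g x))"
proof -
  have "Ck_on k S (\<lambda>x. (f x, 0) + (0, g x))"
    by (rule Ck_on_add[OF assms(1)
          Ck_on_bounded_linear[OF bounded_linear_Pair[OF bounded_linear_ident bounded_linear_zero] assms(1,2)]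
          Ck_on_bounded_linear[OF bounded_linear_Pair[OF bounded_linear_zero bounded_linear_ident] assms(1,3)]])
  then show ?thesis by simp
qed

text \<open>The mean value theorem is applied twice to the alternating sum over the corners of a
  parallelogram, once along each side. The sum itself does not see the order of \<open>v\<close> and
  \<open>w\<close>.\<close>

lemma second_difference:
  fixes f :: "'a::euclidean_space \<Rightarrow> real"
  assumes S: "open S" "Ck_on 2 S f" and t: "t > 0"
    and in_S: "\<And>a b. 0 \<le> a \<Longrightarrow> a \<le> t \<Longrightarrow> 0 \<le> b \<Longrightarrow> b \<le> t \<Longrightarrow> x + a *\<^sub>R v + b *\<^sub>R w \<in> S"
  shows "\<exists>a b. 0 \<le> a \<and> a \<le> t \<and> 0 \<le> b \<and> b \<le> t \<and>
    f (x + t *\<^sub>R v + t *\<^sub>R w) - f (x + t *\<^sub>R v) - f (x + t *\<^sub>R w) + f x =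
    t * t * frechet_derivative (\<lambda>y. frechet_derivative f (at y) v) (at (x + a *\<^sub>R v + b *\<^sub>R w)) w"
proof -
  let ?D = "\<lambda>y. frechet_derivative f (at y)"
  let ?E = "\<lambda>y. frechet_derivative (\<lambda>z. ?D z v) (at y)"
  have C: "Ck_on (Suc (Suc 0)) S f" using S(2) by (simp add: numeral_2_eq_2)
  have D: "(f has_derivative ?D y) (at y)" if "y \<in> S" for y
    by (rule Ck_on_deriv[OF C that])
  have E: "((\<lambda>z. ?D z v) has_derivative ?E y) (at y)" if "y \<in> S" for y
    by (rule Ck_on_deriv[of 0 S]) (use C that in auto)
  have 1: "((\<lambda>a. f (x + a *\<^sub>R v + b *\<^sub>R w)) has_real_derivative ?D (x + a *\<^sub>R v + b *\<^sub>R w) v) (at a)"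
    if "x + a *\<^sub>R v + b *\<^sub>R w \<in> S" for a b
  proof -
    have "((\<lambda>a. x + a *\<^sub>R v + b *\<^sub>R w) has_derivative (\<lambda>r. r *\<^sub>R v)) (at a)"
      by (auto intro!: derivative_eq_intros)
    from has_derivative_compose[OF this D[OF that]] show ?thesis
      unfolding has_field_derivative_def
      using linear_cmul[OF has_derivative_linear[OF D[OF that]]] by (simp add: mult_commute_abs)
  qed
  have 2: "((\<lambda>b. ?D (x + a *\<^sub>R v + b *\<^sub>R w) v) has_real_derivative ?E (x + a *\<^sub>R v + b *\<^sub>R w) w) (at b)"
    if "x + a *\<^sub>R v + b *\<^sub>R w \<in> S" for a b
  proof -
    have "((\<lambda>b. x + a *\<^sub>R v + b *\<^sub>R w) has_derivative (\<lambda>r. r *\<^sub>R w)) (at b)"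
      by (auto intro!: derivative_eq_intros)
    from has_derivative_compose[OF this E[OF that]] show ?thesis
      unfolding has_field_derivative_def
      using linear_cmul[OF has_derivative_linear[OF E[OF that]]] by (simp add: mult_commute_abs)
  qed
  have in_S0: "x + a *\<^sub>R v \<in> S" if "0 \<le> a" "a \<le> t" for a
    using in_S[of a 0] that t by simp
  \<comment> \<open>Mean value theorem along \<open>v\<close> for the difference of \<open>f\<close>
    on two opposite edges. The multiples by zero keep both edges in the common form
    \<open>x + a v + b w\<close>.\<close>
  have "\<exists>a. 0 < a \<and> a < t \<and>
      (f (x + t *\<^sub>R v + t *\<^sub>R w) - f (x + t *\<^sub>R v + 0 *\<^sub>R w))
      - (f (x + 0 *\<^sub>R v + t *\<^sub>R w) - f (x + 0 *\<^sub>R v + 0 *\<^sub>R w)) =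
      (t - 0) * (?D (x + a *\<^sub>R v + t *\<^sub>R w) v - ?D (x + a *\<^sub>R v + 0 *\<^sub>R w) v)"
    using t in_S in_S0 by (intro MVT2 DERIV_diff 1) auto
  then obtain a where a: "0 < a" "a < t"
      "f (x + t *\<^sub>R v + t *\<^sub>R w) - f (x + t *\<^sub>R v) - f (x + t *\<^sub>R w) + f x =
       t * (?D (x + a *\<^sub>R v + t *\<^sub>R w) v - ?D (x + a *\<^sub>R v + 0 *\<^sub>R w) v)"
    by auto
  have "\<exists>b. 0 < b \<and> b < t \<and>
      ?D (x + a *\<^sub>R v + t *\<^sub>R w) v - ?D (x + a *\<^sub>R v + 0 *\<^sub>R w) v =
      (t - 0) * ?E (x + a *\<^sub>R v + b *\<^sub>R w) w"
    using t in_S a by (intro MVT2 2) auto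
  then obtain b where "0 < b" "b < t"
      "?D (x + a *\<^sub>R v + t *\<^sub>R w) v - ?D (x + a *\<^sub>R v + 0 *\<^sub>R w) v = t * ?E (x + a *\<^sub>R v + b *\<^sub>R w) w"
    by auto
  with a show ?thesis
    by (intro exI[of _ a] exI[of _ b]) (simp add: mult.assoc)
qed

text \<open>Schwarz's theorem: both mixed derivatives, taken at points of arbitrarily small
  parallelograms, equal the same difference quotient, and continuity carries the equality to
  \<open>x\<close>.\<close>

lemma second_derivative_symmetric_real:
  fixes f :: "'a::euclidean_space \<Rightarrow> real"
  assumes S: "open S" "Ck_on 2 S f" "x \<in> S"
  shows "frechet_derivative (\<lambda>y. frechet_derivative f (at y) v) (at x) w =
         frechet_derivative (\<lambda>y. frechet_derivative f (at y) w) (at x) v"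
proof (rule ccontr)
  define E where "E v w y = frechet_derivative (\<lambda>z. frechet_derivative f (at z) v) (at y) w" for v w y
  assume "\<not> ?thesis"
  then have ne: "E v w x \<noteq> E w v x" by (simp add: E_def)
  \<comment> \<open>Half the supposed gap, so that the two values cannot both be approximated within
    \<open>e\<close> by one number.\<close>
  define e where "e = \<bar>E v w x - E w v x\<bar> / 2"
  have e: "e > 0" using ne by (simp add: e_def)
  have "continuous_on S (E v w)" for v w
    using S(2) by (simp add: numeral_2_eq_2 E_def[abs_def])
  then have cont: "isCont (E v w) x" for v w using S by (simp add: continuous_on_eq_continuous_at)
  from cont[of v w] e obtain d1 where d1: "d1 > 0" "\<And>y. dist y x < d1 \<Longrightarrow> dist (E v w y) (E v w x) < e"
    unfolding continuous_at_eps_delta by blast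
  from cont[of w v] e obtain d2 where d2: "d2 > 0" "\<And>y. dist y x < d2 \<Longrightarrow> dist (E w v y) (E w v x) < e"
    unfolding continuous_at_eps_delta by blast
  obtain d3 where d3: "d3 > 0" "\<And>y. dist y x < d3 \<Longrightarrow> y \<in> S"
    using S open_dist by metis
  define d where "d = min d1 (min d2 d3)"
  \<comment> \<open>The sides are scaled so that the parallelogram has displacement at most
    \<open>t * K = d / 2\<close>. The summand 1 keeps \<open>K\<close> positive when both vectors
    vanish.\<close>
  define K where "K = norm v + norm w + 1"
  define t where "t = d / (2 * K)"
  have d: "d > 0" using d1 d2 d3 by (simp add: d_def)
  have pos: "K > 0" unfolding K_def by (smt (verit) norm_ge_zero)
  have t: "t > 0" using d pos by (simp add: t_def)
  have near: "dist (x + a *\<^sub>R v + b *\<^sub>R w) x < d" if "0 \<le> a" "a \<le> t" "0 \<le> b" "b \<le> t" for a b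
  proof -
    have "dist (x + a *\<^sub>R v + b *\<^sub>R w) x = norm (a *\<^sub>R v + b *\<^sub>R w)"
      by (simp add: dist_norm add.assoc)
    also have "\<dots> \<le> a * norm v + b * norm w"
      using norm_triangle_ineq[of "a *\<^sub>R v" "b *\<^sub>R w"] that by simp
    also have "\<dots> \<le> t * norm v + t * norm w"
      using that by (intro add_mono mult_right_mono) auto
    also have "\<dots> \<le> t * K" using t by (simp add: K_def algebra_simps)
    also have "\<dots> = d / 2" using pos by (simp add: t_def)
    also have "\<dots> < d" using d by simp
    finally show ?thesis .
  qed
  obtain a b where ab: "0 \<le> a" "a \<le> t" "0 \<le> b" "b \<le> t"
    "f (x + t *\<^sub>R v + t *\<^sub>R w) - f (x + t *\<^sub>R v) - f (x + t *\<^sub>R w) + f x = t * t * E v w (x + a *\<^sub>R v + b *\<^sub>R w)"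
    using second_difference[OF S(1,2) t, of x v w] near d3 unfolding E_def d_def by (smt (verit))
  obtain a' b' where ab': "0 \<le> a'" "a' \<le> t" "0 \<le> b'" "b' \<le> t"
    "f (x + t *\<^sub>R w + t *\<^sub>R v) - f (x + t *\<^sub>R w) - f (x + t *\<^sub>R v) + f x = t * t * E w v (x + a' *\<^sub>R w + b' *\<^sub>R v)"
  proof -
    have "x + a *\<^sub>R w + b *\<^sub>R v \<in> S" if "0 \<le> a" "a \<le> t" "0 \<le> b" "b \<le> t" for a b
      using near[of b a] that d3(2)[of "x + b *\<^sub>R v + a *\<^sub>R w"] by (simp add: d_def add.commute add.left_commute)
    then show ?thesis
      using second_difference[OF S(1,2) t, of x w v] that unfolding E_def by blast
  qed
  \<comment> \<open>Exchanging \<open>v\<close> and \<open>w\<close> permutes the corners and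
    preserves the alternating sum.\<close>
  have "t * t * E v w (x + a *\<^sub>R v + b *\<^sub>R w) = t * t * E w v (x + b' *\<^sub>R v + a' *\<^sub>R w)"
  proof -
    have "x + t *\<^sub>R w + t *\<^sub>R v = x + t *\<^sub>R v + t *\<^sub>R w"
      "x + a' *\<^sub>R w + b' *\<^sub>R v = x + b' *\<^sub>R v + a' *\<^sub>R w" by simp_all
    with ab(5) ab'(5) show ?thesis by (simp only:)
  qed
  then have "E v w (x + a *\<^sub>R v + b *\<^sub>R w) = E w v (x + b' *\<^sub>R v + a' *\<^sub>R w)" using t by simp
  moreover have "dist (E v w (x + a *\<^sub>R v + b *\<^sub>R w)) (E v w x) < e"
    using near[of a b] ab d1 by (simp add: d_def)
  moreover have "dist (E w v (x + b' *\<^sub>R v + a' *\<^sub>R w)) (E w v x) < e"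
    using near[of b' a'] ab' d2 by (simp add: d_def)
  ultimately show False by (simp add: e_def dist_real_def abs_if split: if_splits)
qed

lemma frechet_derivative_inner:
  assumes "f differentiable (at x)"
  shows "frechet_derivative (\<lambda>y. f y \<bullet> b) (at x) v = frechet_derivative f (at x) v \<bullet> b"
proof -
  have "(f has_derivative frechet_derivative f (at x)) (at x)"
    using assms by (simp add: frechet_derivative_works)
  from has_derivative_inner_left[OF this, of b] show ?thesis
    by (metis frechet_derivative_at)
qed

text \<open>Pairing with a fixed basis vector commutes with differentiation, which reduces the claim
  to real-valued components.\<close>

lemma second_derivative_symmetric:
  fixes f :: "'a::euclidean_space \<Rightarrow> 'b::euclidean_space"
  assumes S: "open S" "Ck_on 2 S f" "x \<in> S"
  shows "frechet_derivative (\<lambda>y. frechet_derivative f (at y) v) (at x) w =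
         frechet_derivative (\<lambda>y. frechet_derivative f (at y) w) (at x) v"
proof (rule euclidean_eqI)
  fix b :: 'b assume "b \<in> Basis"
  let ?D = "\<lambda>v y. frechet_derivative f (at y) v"
  have C: "Ck_on (Suc (Suc 0)) S f" using S(2) by (simp add: numeral_2_eq_2)
  have *: "frechet_derivative (\<lambda>y. frechet_derivative (\<lambda>z. f z \<bullet> b) (at y) v) (at x) w
    = frechet_derivative (?D v) (at x) w \<bullet> b" for v w
  proof -
    have "?D v differentiable (at x)" using C S(3) by simp
    then have 1: "((\<lambda>y. ?D v y \<bullet> b) has_derivative (\<lambda>w. frechet_derivative (?D v) (at x) w \<bullet> b)) (at x)"
      using has_derivative_inner_left by (metis frechet_derivative_works)
    have "((\<lambda>y. frechet_derivative (\<lambda>z. f z \<bullet> b) (at y) v) has_derivative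
        (\<lambda>w. frechet_derivative (?D v) (at x) w \<bullet> b)) (at x)"
      by (rule has_derivative_transform_within_open[OF 1 S(1,3)])
        (use C in \<open>simp add: frechet_derivative_inner\<close>)
    then show ?thesis by (metis frechet_derivative_at)
  qed
  have "Ck_on 2 S (\<lambda>z. f z \<bullet> b)"
    by (rule Ck_on_bounded_linear[OF bounded_linear_inner_left S(1,2)])
  from second_derivative_symmetric_real[OF S(1) this S(3), of v w]
  show "frechet_derivative (?D v) (at x) w \<bullet> b = frechet_derivative (?D w) (at x) v \<bullet> b"
    unfolding * by auto
qed

section \<open>Calculus of smooth maps, inherited from every finite order\<close>

lemma smooth_on_subset: "smooth_on S f \<Longrightarrow> T \<subseteq> S \<Longrightarrow> smooth_on T f"
  by (auto simp: smooth_on_def intro: Ck_on_subset)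

lemma smooth_on_cong:
  "open S \<Longrightarrow> (\<And>x. x \<in> S \<Longrightarrow> f x = g x) \<Longrightarrow> smooth_on S f \<Longrightarrow> smooth_on S g"
  unfolding smooth_on_def using Ck_on_cong by blast

lemma smooth_on_local:
  "(\<And>x. x \<in> S \<Longrightarrow> \<exists>T. open T \<and> x \<in> T \<and> smooth_on T f) \<Longrightarrow> smooth_on S f"
  unfolding smooth_on_def by (meson Ck_on_local)

lemma smooth_on_const: "open S \<Longrightarrow> smooth_on S (\<lambda>x. c)"
  by (simp add: smooth_on_def Ck_on_const)

lemma smooth_on_bounded_linear:
  "bounded_linear L \<Longrightarrow> open S \<Longrightarrow> smooth_on S f \<Longrightarrow> smooth_on S (\<lambda>x. L (f x))"
  by (simp add: smooth_on_def Ck_on_bounded_linear)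

lemma smooth_on_add:
  "open S \<Longrightarrow> smooth_on S f \<Longrightarrow> smooth_on S g \<Longrightarrow> smooth_on S (\<lambda>x. f x + g x)"
  by (simp add: smooth_on_def Ck_on_add)

lemma smooth_on_diff:
  assumes "open S" "smooth_on S f" "smooth_on S g"
  shows "smooth_on S (\<lambda>x. f x - g x)"
  using smooth_on_add[OF assms(1,2) smooth_on_bounded_linear[OF
        bounded_linear_minus[OF bounded_linear_ident] assms(1,3)]] by simp

lemma smooth_on_sum:
  "open S \<Longrightarrow> finite J \<Longrightarrow> (\<And>i. i \<in> J \<Longrightarrow> smooth_on S (f i)) \<Longrightarrow> smooth_on S (\<lambda>x. \<Sum>i\<in>J. f i x)"
  by (simp add: smooth_on_def Ck_on_sum)

lemma smooth_on_bilinear: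
  "bounded_bilinear B \<Longrightarrow> open S \<Longrightarrow> smooth_on S f \<Longrightarrow> smooth_on S g \<Longrightarrow> smooth_on S (\<lambda>x. B (f x) (g x))"
  by (simp add: smooth_on_def Ck_on_bilinear)

lemma smooth_on_Pair:
  "open S \<Longrightarrow> smooth_on S f \<Longrightarrow> smooth_on S g \<Longrightarrow> smooth_on S (\<lambda>x. (f x, g x))"
  by (simp add: smooth_on_def Ck_on_Pair)

lemma smooth_on_compose:
  "open S \<Longrightarrow> open T \<Longrightarrow> f ` S \<subseteq> T \<Longrightarrow> smooth_on S f \<Longrightarrow> smooth_on T g \<Longrightarrow> smooth_on S (\<lambda>x. g (f x))"
  unfolding smooth_on_def by (blast intro: Ck_on_compose)

lemma smooth_on_differentiable: "smooth_on S f \<Longrightarrow> x \<in> S \<Longrightarrow> f differentiable (at x)"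
  unfolding smooth_on_def by (metis Ck_on.simps(2))

lemma smooth_on_has_derivative:
  "smooth_on S f \<Longrightarrow> x \<in> S \<Longrightarrow> (f has_derivative frechet_derivative f (at x)) (at x)"
  using smooth_on_differentiable frechet_derivative_works by blast

lemma smooth_on_frechet_derivative: "smooth_on S f \<Longrightarrow> smooth_on S (\<lambda>x. frechet_derivative f (at x) v)"
  unfolding smooth_on_def by (metis Ck_on.simps(2))

lemma smooth_on_second_derivative_symmetric:
  assumes "open S" "smooth_on S f" "x \<in> S"
  shows "frechet_derivative (\<lambda>y. frechet_derivative f (at y) v) (at x) w =
         frechet_derivative (\<lambda>y. frechet_derivative f (at y) w) (at x) v"
  using assms second_derivative_symmetric unfolding smooth_on_def by blast

lemma frechet_derivative_diff:
  assumes "f differentiable (at x)" "g differentiable (at x)"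
  shows "frechet_derivative (\<lambda>y. f y - g y) (at x) v = frechet_derivative f (at x) v - frechet_derivative g (at x) v"
  using frechet_derivative_at[OF has_derivative_diff[OF assms[unfolded frechet_derivative_works]]] by metis

subsection \<open>Pullback and exterior derivative of 1-forms on Euclidean spaces\<close>

context
  fixes X :: "'a::euclidean_space set" and Y :: "'b::euclidean_space set"
    and \<sigma> :: "'a \<Rightarrow> 'b" and A :: "'b \<Rightarrow> 'b \<Rightarrow> real"
  assumes X: "open X" and Y: "open Y" and \<sigma>: "smooth_on X \<sigma>" "\<sigma> ` X \<subseteq> Y"
    and A: "\<And>y. y \<in> Y \<Longrightarrow> linear (A y)" "\<And>v. smooth_on Y (\<lambda>y. A y v)"
begin

lemma form_apply_Basis: "x \<in> X \<Longrightarrow> A (\<sigma> x) v = (\<Sum>b\<in>Basis. (v \<bullet> b) * A (\<sigma> x) b)"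
  using linear_frechet_Basis[OF A(1), of "\<sigma> x" v] \<sigma>(2) by auto

text \<open>A form is smooth on fixed vectors only; a vector field is fed in through its basis
  coefficients.\<close>

lemma smooth_on_form_apply:
  assumes "smooth_on X \<tau>"
  shows "smooth_on X (\<lambda>x. A (\<sigma> x) (\<tau> x))"
proof (rule smooth_on_cong[OF X])
  show "smooth_on X (\<lambda>x. \<Sum>b\<in>Basis. (\<tau> x \<bullet> b) * A (\<sigma> x) b)"
    by (intro smooth_on_sum X finite_Basis smooth_on_bilinear[OF bounded_bilinear_mult]
        smooth_on_bounded_linear[OF bounded_linear_inner_left] assms smooth_on_compose[OF X Y \<sigma>(2,1)] A(2))
  show "(\<Sum>b\<in>Basis. (\<tau> x \<bullet> b) * A (\<sigma> x) b) = A (\<sigma> x) (\<tau> x)" if "x \<in> X" for x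
    by (rule form_apply_Basis[OF that, symmetric])
qed

text \<open>Product rule for evaluating a form on a field along \<open>\<sigma>\<close>: one term
  varies the vector, where the form is linear, the other varies the base point.\<close>

lemma frechet_derivative_form_apply:
  assumes \<tau>: "smooth_on X \<tau>" and x: "x \<in> X"
  shows "frechet_derivative (\<lambda>z. A (\<sigma> z) (\<tau> z)) (at x) v =
     A (\<sigma> x) (frechet_derivative \<tau> (at x) v)
     + frechet_derivative (\<lambda>y. A y (\<tau> x)) (at (\<sigma> x)) (frechet_derivative \<sigma> (at x) v)"
proof -
  let ?s = "frechet_derivative \<sigma> (at x)" and ?t = "frechet_derivative \<tau> (at x)"
  let ?A = "\<lambda>u. frechet_derivative (\<lambda>y. A y u) (at (\<sigma> x))"
  have \<sigma>x: "\<sigma> x \<in> Y" using x \<sigma>(2) by auto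
  have DA: "((\<lambda>y. A y u) has_derivative ?A u) (at (\<sigma> x))" for u
    by (rule smooth_on_has_derivative[OF A(2) \<sigma>x])
  have "((\<lambda>y. \<Sum>b\<in>Basis. (u \<bullet> b) * A y b) has_derivative (\<lambda>w. \<Sum>b\<in>Basis. (u \<bullet> b) * ?A b w)) (at (\<sigma> x))" for u
    by (intro has_derivative_sum has_derivative_mult_right DA)
  then have "((\<lambda>y. A y u) has_derivative (\<lambda>w. \<Sum>b\<in>Basis. (u \<bullet> b) * ?A b w)) (at (\<sigma> x))" for u
    by (rule has_derivative_transform_within_open[OF _ Y \<sigma>x])
      (rule linear_frechet_Basis[OF A(1), of _ u, unfolded real_scaleR_def, symmetric])
  from fun_cong[OF frechet_derivative_at[OF this]]
  have A_Basis: "?A u w = (\<Sum>b\<in>Basis. (u \<bullet> b) * ?A b w)" for u w by simp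
  have "((\<lambda>z. \<Sum>b\<in>Basis. (\<tau> z \<bullet> b) * A (\<sigma> z) b) has_derivative
      (\<lambda>v. \<Sum>b\<in>Basis. (\<tau> x \<bullet> b) * ?A b (?s v) + (?t v \<bullet> b) * A (\<sigma> x) b)) (at x)"
    by (intro has_derivative_sum has_derivative_mult has_derivative_inner_left
        smooth_on_has_derivative[OF \<tau> x] has_derivative_compose[OF smooth_on_has_derivative[OF \<sigma>(1) x] DA])
  then have "((\<lambda>z. A (\<sigma> z) (\<tau> z)) has_derivative
      (\<lambda>v. \<Sum>b\<in>Basis. (\<tau> x \<bullet> b) * ?A b (?s v) + (?t v \<bullet> b) * A (\<sigma> x) b)) (at x)"
    by (rule has_derivative_transform_within_open[OF _ X x]) (rule form_apply_Basis[symmetric])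
  from fun_cong[OF frechet_derivative_at[OF this], of v]
  show ?thesis unfolding A_Basis[of "\<tau> x"] form_apply_Basis[OF x, of "?t v"] by (simp add: sum.distrib)
qed

text \<open>The exterior derivative commutes with pullback: the terms containing the second
  derivative of \<open>\<sigma>\<close> are symmetric in \<open>v\<close> and \<open>w\<close> and
  cancel under antisymmetrization.\<close>

lemma exterior_derivative_pullback:
  assumes x: "x \<in> X"
  shows "frechet_derivative (\<lambda>z. A (\<sigma> z) (frechet_derivative \<sigma> (at z) w)) (at x) v
       - frechet_derivative (\<lambda>z. A (\<sigma> z) (frechet_derivative \<sigma> (at z) v)) (at x) w =
      frechet_derivative (\<lambda>y. A y (frechet_derivative \<sigma> (at x) w)) (at (\<sigma> x)) (frechet_derivative \<sigma> (at x) v)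
    - frechet_derivative (\<lambda>y. A y (frechet_derivative \<sigma> (at x) v)) (at (\<sigma> x)) (frechet_derivative \<sigma> (at x) w)"
  using frechet_derivative_form_apply[OF smooth_on_frechet_derivative[OF \<sigma>(1)] x]
    smooth_on_second_derivative_symmetric[OF X \<sigma>(1) x, of v w] by simp

end

text \<open>Coordinate form of \<open>d d = 0\<close>: the cyclic sum has six second derivatives,
  which cancel in pairs by symmetry.\<close>

lemma exterior_derivative_twice:
  fixes A :: "'a::euclidean_space \<Rightarrow> 'a \<Rightarrow> real"
  assumes X: "open X" "x \<in> X" and A: "\<And>v. smooth_on X (\<lambda>y. A y v)"
  defines "\<omega> \<equiv> \<lambda>v w y. frechet_derivative (\<lambda>y. A y w) (at y) v - frechet_derivative (\<lambda>y. A y v) (at y) w"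
  shows "frechet_derivative (\<omega> v w) (at x) u + frechet_derivative (\<omega> w u) (at x) v
       + frechet_derivative (\<omega> u v) (at x) w = 0"
proof -
  have "frechet_derivative (\<omega> v w) (at x) u =
      frechet_derivative (\<lambda>y. frechet_derivative (\<lambda>y. A y w) (at y) v) (at x) u
    - frechet_derivative (\<lambda>y. frechet_derivative (\<lambda>y. A y v) (at y) w) (at x) u" for u v w
    unfolding \<omega>_def
    by (intro frechet_derivative_diff smooth_on_differentiable[OF _ X(2)] smooth_on_frechet_derivative A)
  then show ?thesis
    using smooth_on_second_derivative_symmetric[OF X(1) A X(2)] by simp
qed

subsection \<open>Charts and smooth maps\<close>

text \<open>The topological part of the atlas conditions. Intermediate spaces in a composition of
  smooth maps need just this, so the circle and its products are checked only for charts that cover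
  and are homeomorphisms onto open sets.\<close>

definition charted :: "('a, 'e::euclidean_space) mfd \<Rightarrow> bool" where
  "charted M \<longleftrightarrow> (\<Union>c\<in>atlas M. fst c) = topspace (mtop M) \<and>
     (\<forall>c\<in>atlas M. openin (mtop M) (fst c) \<and> open (snd c ` fst c) \<and>
        homeomorphic_map (subtopology (mtop M) (fst c)) (top_of_set (snd c ` fst c)) (snd c))"

lemma smooth_manifold_charted: "smooth_manifold M \<Longrightarrow> charted M"
  by (auto simp: smooth_manifold_def charted_def)

lemma charted_cover: "charted M \<Longrightarrow> p \<in> topspace (mtop M) \<Longrightarrow> \<exists>c\<in>atlas M. p \<in> fst c"
  unfolding charted_def by blast

lemma charted_openin: "charted M \<Longrightarrow> c \<in> atlas M \<Longrightarrow> openin (mtop M) (fst c)"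
  unfolding charted_def by blast

lemma charted_open: "charted M \<Longrightarrow> c \<in> atlas M \<Longrightarrow> open (snd c ` fst c)"
  unfolding charted_def by blast

lemma charted_topspace: "charted M \<Longrightarrow> c \<in> atlas M \<Longrightarrow> p \<in> fst c \<Longrightarrow> p \<in> topspace (mtop M)"
  unfolding charted_def by blast

lemma charted_inj:
  assumes "charted M" "c \<in> atlas M"
  shows "inj_on (snd c) (fst c)"
proof -
  have "homeomorphic_map (subtopology (mtop M) (fst c)) (top_of_set (snd c ` fst c)) (snd c)"
    using assms by (auto simp: charted_def)
  then have "inj_on (snd c) (topspace (subtopology (mtop M) (fst c)))"
    by (rule homeomorphic_imp_injective_map)
  then show ?thesis
    using openin_subset[OF charted_openin[OF assms]] by (simp add: inf.absorb2)
qed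

lemma chart_inv [simp]: "charted M \<Longrightarrow> c \<in> atlas M \<Longrightarrow> p \<in> fst c \<Longrightarrow> chart_inv c (snd c p) = p"
  unfolding chart_inv_def by (simp add: inv_into_f_f charted_inj)

lemma charted_open_image:
  assumes M: "charted M" "c \<in> atlas M" and U: "openin (mtop M) U" "U \<subseteq> fst c"
  shows "open (snd c ` U)"
proof -
  have hom: "homeomorphic_map (subtopology (mtop M) (fst c)) (top_of_set (snd c ` fst c)) (snd c)"
    using M by (auto simp: charted_def)
  have "U \<subseteq> topspace (subtopology (mtop M) (fst c))"
    using U openin_subset by fastforce
  moreover have "openin (subtopology (mtop M) (fst c)) U"
    using U by (metis inf.absorb1 openin_subtopology)
  ultimately have "openin (top_of_set (snd c ` fst c)) (snd c ` U)"
    using homeomorphic_map_openness[OF hom] by blast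
  then show ?thesis
    using charted_open[OF M] openin_open_trans by blast
qed

lemma smooth_map_openin_preimage:
  assumes f: "smooth_map M M' S f" and W: "openin (mtop M') W"
  shows "openin (mtop M) {p \<in> S. f p \<in> W}"
proof -
  have S: "openin (mtop M) S" and f: "continuous_map (subtopology (mtop M) S) (mtop M') f"
    using f by (auto simp: smooth_map_def)
  have "openin (subtopology (mtop M) S) {p \<in> topspace (subtopology (mtop M) S). f p \<in> W}"
    by (rule openin_continuous_map_preimage[OF f W])
  also have "{p \<in> topspace (subtopology (mtop M) S). f p \<in> W} = {p \<in> S. f p \<in> W}"
    using openin_subset[OF S] by auto
  finally show ?thesis
    using S openin_trans_full by blast
qed

lemma smooth_map_open_domain:
  assumes M: "charted M" "c \<in> atlas M" and f: "smooth_map M M' S f" and W: "openin (mtop M') W"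
  shows "open (snd c ` {p \<in> S \<inter> fst c. f p \<in> W})"
proof (rule charted_open_image[OF M])
  have "{p \<in> S \<inter> fst c. f p \<in> W} = {p \<in> S. f p \<in> W} \<inter> fst c" by auto
  then show "openin (mtop M) {p \<in> S \<inter> fst c. f p \<in> W}"
    using smooth_map_openin_preimage[OF f W] charted_openin[OF M] by auto
qed auto

lemma smooth_map_rep:
  assumes "smooth_map M M' S f" "c \<in> atlas M" "d \<in> atlas M'"
  shows "smooth_on (snd c ` {p \<in> S \<inter> fst c. f p \<in> fst d}) (snd d \<circ> f \<circ> chart_inv c)"
  using assms by (auto simp: smooth_map_def)

lemma smooth_map_in_topspace:
  assumes "smooth_map M M' S f" "p \<in> S"
  shows "f p \<in> topspace (mtop M')"
proof -
  have "openin (mtop M) S" "continuous_map (subtopology (mtop M) S) (mtop M') f"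
    using assms by (auto simp: smooth_map_def)
  moreover have "p \<in> topspace (subtopology (mtop M) S)"
    using assms(2) openin_subset[OF \<open>openin (mtop M) S\<close>] by auto
  ultimately show ?thesis using continuous_map_image_subset_topspace by fastforce
qed

text \<open>Coordinate representations compose only where one chart of the middle space contains the
  intermediate values, so a chart around \<open>f p\<close> is fixed and smoothness is shown near
  \<open>p\<close>.\<close>

lemma smooth_map_compose:
  assumes M: "charted M" and M': "charted M'" and M'': "charted M''"
    and f: "smooth_map M M' S f" and g: "smooth_map M' M'' T g" and fS: "f ` S \<subseteq> T"
  shows "smooth_map M M'' S (\<lambda>p. g (f p))"
  unfolding smooth_map_def
proof (intro conjI ballI)
  show "openin (mtop M) S" using f by (simp add: smooth_map_def)
  have "continuous_map (subtopology (mtop M) S) (subtopology (mtop M') T) f"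
    using f fS by (auto simp: smooth_map_def continuous_map_in_subtopology)
  then show "continuous_map (subtopology (mtop M) S) (mtop M'') (\<lambda>p. g (f p))"
    using g continuous_map_compose unfolding smooth_map_def comp_def by fastforce
  fix c e assume c: "c \<in> atlas M" and e: "e \<in> atlas M''"
  show "smooth_on (snd c ` {p \<in> S \<inter> fst c. g (f p) \<in> fst e}) (snd e \<circ> (\<lambda>p. g (f p)) \<circ> chart_inv c)"
  proof (rule smooth_on_local)
    fix x assume "x \<in> snd c ` {p \<in> S \<inter> fst c. g (f p) \<in> fst e}"
    then obtain p where p: "p \<in> S" "p \<in> fst c" "g (f p) \<in> fst e" "x = snd c p" by auto
    obtain d where d: "d \<in> atlas M'" "f p \<in> fst d"
      using charted_cover[OF M' smooth_map_in_topspace[OF f p(1)]] by blast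
    show "\<exists>W. open W \<and> x \<in> W \<and> smooth_on W (snd e \<circ> (\<lambda>p. g (f p)) \<circ> chart_inv c)"
    proof (intro exI conjI)
      let ?V = "fst d \<inter> {y \<in> T. g y \<in> fst e}"
      let ?W = "snd c ` {q \<in> S \<inter> fst c. f q \<in> ?V}"
      have V: "openin (mtop M') ?V"
        using smooth_map_openin_preimage[OF g charted_openin[OF M'' e]] charted_openin[OF M' d(1)] by auto
      show W: "open ?W" by (rule smooth_map_open_domain[OF M c f V])
      show "x \<in> ?W" using p d fS by auto
      have "smooth_on ?W (\<lambda>x. (snd e \<circ> g \<circ> chart_inv d) ((snd d \<circ> f \<circ> chart_inv c) x))"
      proof (rule smooth_on_compose[OF W _ _ _ smooth_map_rep[OF g d(1) e]])
        show "open (snd d ` {p \<in> T \<inter> fst d. g p \<in> fst e})"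
          by (rule smooth_map_open_domain[OF M' d(1) g charted_openin[OF M'' e]])
        show "smooth_on ?W (snd d \<circ> f \<circ> chart_inv c)"
          by (rule smooth_on_subset[OF smooth_map_rep[OF f c d(1)]]) auto
      qed (use M c in auto)
      then show "smooth_on ?W (snd e \<circ> (\<lambda>p. g (f p)) \<circ> chart_inv c)"
        by (rule smooth_on_cong[OF W, rotated]) (use M M' c d in auto)
    qed
  qed
qed

text \<open>Coordinate representations of the identity are the transition maps, so this is where
  compatibility of the charts enters.\<close>

lemma smooth_map_id:
  assumes M: "smooth_manifold M" and S: "openin (mtop M) S"
  shows "smooth_map M M S (\<lambda>p. p)"
  unfolding smooth_map_def
proof (intro conjI ballI S)
  show "continuous_map (subtopology (mtop M) S) (mtop M) (\<lambda>p. p)"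
    by (simp add: continuous_map_from_subtopology)
  fix c d assume "c \<in> atlas M" "d \<in> atlas M"
  then have "smooth_on (snd c ` (fst c \<inter> fst d)) (snd d \<circ> chart_inv c)"
    using M by (auto simp: smooth_manifold_def)
  then show "smooth_on (snd c ` {p \<in> S \<inter> fst c. p \<in> fst d}) (snd d \<circ> (\<lambda>p. p) \<circ> chart_inv c)"
    by (auto simp: comp_def elim!: smooth_on_subset)
qed

lemma smooth_map_const:
  assumes M: "charted M" and S: "openin (mtop M) S" and y: "y \<in> topspace (mtop M')"
  shows "smooth_map M M' S (\<lambda>p. y)"
  unfolding smooth_map_def
proof (intro conjI ballI S)
  show "continuous_map (subtopology (mtop M) S) (mtop M') (\<lambda>p. y)" using y by simp
  fix c d assume c: "c \<in> atlas M" and "d \<in> atlas M'"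
  have "openin (mtop M) (S \<inter> fst c)" using S charted_openin[OF M c] by auto
  then have "smooth_on (snd c ` (S \<inter> fst c)) (\<lambda>x. snd d y)"
    by (intro smooth_on_const charted_open_image[OF M c]) auto
  then show "smooth_on (snd c ` {p \<in> S \<inter> fst c. y \<in> fst d}) (snd d \<circ> (\<lambda>p. y) \<circ> chart_inv c)"
    by (auto simp: comp_def elim!: smooth_on_subset)
qed

lemma smooth_map_Pair:
  assumes M: "charted M" and M': "charted M'" and M'': "charted M''"
    and f: "smooth_map M M' S f" and g: "smooth_map M M'' S g"
  shows "smooth_map M (mfd_prod M' M'') S (\<lambda>p. (f p, g p))"
  unfolding smooth_map_def
proof (intro conjI ballI)
  show "openin (mtop M) S" using f by (simp add: smooth_map_def)
  show "continuous_map (subtopology (mtop M) S) (mtop (mfd_prod M' M'')) (\<lambda>p. (f p, g p))"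
    using f g by (auto simp: mfd_prod_def smooth_map_def intro: continuous_map_pairedI)
  fix c cd assume c: "c \<in> atlas M" and cd: "cd \<in> atlas (mfd_prod M' M'')"
  then obtain d e where d: "d \<in> atlas M'" and e: "e \<in> atlas M''"
    and cd: "cd = (fst d \<times> fst e, map_prod (snd d) (snd e))"
    by (auto simp: mfd_prod_def)
  let ?W = "{p \<in> S \<inter> fst c. f p \<in> fst d \<and> g p \<in> fst e}"
  have "?W = {p \<in> S. f p \<in> fst d} \<inter> {p \<in> S. g p \<in> fst e} \<inter> fst c" by auto
  then have "openin (mtop M) ?W"
    using smooth_map_openin_preimage[OF f charted_openin[OF M' d]]
      smooth_map_openin_preimage[OF g charted_openin[OF M'' e]] charted_openin[OF M c] by auto
  then have "open (snd c ` ?W)" by (rule charted_open_image[OF M c]) auto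
  then have "smooth_on (snd c ` ?W) (\<lambda>x. ((snd d \<circ> f \<circ> chart_inv c) x, (snd e \<circ> g \<circ> chart_inv c) x))"
  proof (rule smooth_on_Pair)
    show "smooth_on (snd c ` ?W) (snd d \<circ> f \<circ> chart_inv c)"
      by (rule smooth_on_subset[OF smooth_map_rep[OF f c d]]) auto
    show "smooth_on (snd c ` ?W) (snd e \<circ> g \<circ> chart_inv c)"
      by (rule smooth_on_subset[OF smooth_map_rep[OF g c e]]) auto
  qed
  moreover have "(\<lambda>x. ((snd d \<circ> f \<circ> chart_inv c) x, (snd e \<circ> g \<circ> chart_inv c) x)) =
     snd cd \<circ> (\<lambda>p. (f p, g p)) \<circ> chart_inv c" by (auto simp: cd)
  ultimately show "smooth_on (snd c ` {p \<in> S \<inter> fst c. (f p, g p) \<in> fst cd}) (snd cd \<circ> (\<lambda>p. (f p, g p)) \<circ> chart_inv c)"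
    by (simp add: cd)
qed

lemma prod_chart_in_atlas:
  "c \<in> atlas M \<Longrightarrow> d \<in> atlas M' \<Longrightarrow> (fst c \<times> fst d, map_prod (snd c) (snd d)) \<in> atlas (mfd_prod M M')"
  by (simp only: mfd_prod_def mfd.simps) blast

lemma charted_mfd_prod:
  assumes M: "charted M" and M': "charted M'"
  shows "charted (mfd_prod M M')"
  unfolding charted_def
proof (intro conjI ballI)
  have "(\<Union>cd\<in>atlas (mfd_prod M M'). fst cd) = (\<Union>c\<in>atlas M. fst c) \<times> (\<Union>d\<in>atlas M'. fst d)"
  proof (intro set_eqI iffI)
    fix x assume "x \<in> (\<Union>c\<in>atlas M. fst c) \<times> (\<Union>d\<in>atlas M'. fst d)"
    then obtain c d where "c \<in> atlas M" "fst x \<in> fst c" "d \<in> atlas M'" "snd x \<in> fst d" by auto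
    then show "x \<in> (\<Union>cd\<in>atlas (mfd_prod M M'). fst cd)"
      by (intro UN_I[OF prod_chart_in_atlas]) (auto simp: mem_Times_iff)
  qed (auto simp: mfd_prod_def)
  then show "(\<Union>cd\<in>atlas (mfd_prod M M'). fst cd) = topspace (mtop (mfd_prod M M'))"
    using M M' by (simp add: charted_def mfd_prod_def)
  fix cd assume "cd \<in> atlas (mfd_prod M M')"
  then obtain c d where c: "c \<in> atlas M" and d: "d \<in> atlas M'"
    and cd: "cd = (fst c \<times> fst d, map_prod (snd c) (snd d))"
    by (auto simp: mfd_prod_def)
  have im: "snd cd ` fst cd = (snd c ` fst c) \<times> (snd d ` fst d)"
    by (auto simp: cd)
  show "openin (mtop (mfd_prod M M')) (fst cd)"
    using charted_openin[OF M c] charted_openin[OF M' d] by (simp add: cd mfd_prod_def openin_prod_Times_iff)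
  show "open (snd cd ` fst cd)"
    unfolding im by (intro open_Times charted_open[OF M c] charted_open[OF M' d])
  obtain gc gd where "homeomorphic_maps (subtopology (mtop M) (fst c)) (top_of_set (snd c ` fst c)) (snd c) gc"
     "homeomorphic_maps (subtopology (mtop M') (fst d)) (top_of_set (snd d ` fst d)) (snd d) gd"
    using M M' c d unfolding charted_def homeomorphic_map_maps by meson
  then have "homeomorphic_maps (prod_topology (subtopology (mtop M) (fst c)) (subtopology (mtop M') (fst d)))
      (prod_topology (top_of_set (snd c ` fst c)) (top_of_set (snd d ` fst d)))
      (\<lambda>(x, y). (snd c x, snd d y)) (\<lambda>(x, y). (gc x, gd y))"
    unfolding homeomorphic_maps_prod by blast
  moreover have "(\<lambda>(x, y). (snd c x, snd d y)) = snd cd" by (auto simp: cd)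
  ultimately show "homeomorphic_map (subtopology (mtop (mfd_prod M M')) (fst cd)) (top_of_set (snd cd ` fst cd)) (snd cd)"
    unfolding im homeomorphic_map_maps by (auto simp: cd mfd_prod_def subtopology_Times)
qed

text \<open>The chart is the branch of the argument centred at \<open>a\<close>, with inverse
  \<open>cis\<close>. Multiplication by \<open>cis (- a)\<close> rotates the omitted point to -1,
  where the circle meets the cut of \<open>Arg\<close>.\<close>

lemma circle_chart:
  fixes a :: real
  defines "C \<equiv> sphere 0 1 - {- cis a}" and "k \<equiv> \<lambda>z. a + Arg (z * cis (- a))"
  shows "z \<in> C \<Longrightarrow> cis (k z) = z" "z \<in> C \<Longrightarrow> k z \<in> {a - pi<..<a + pi}"
    and "\<theta> \<in> {a - pi<..<a + pi} \<Longrightarrow> cis \<theta> \<in> C" "\<theta> \<in> {a - pi<..<a + pi} \<Longrightarrow> k (cis \<theta>) = \<theta>"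
    and "continuous_on C k"
proof -
  have z: "z * cis (- a) \<notin> \<real>\<^sub>\<le>\<^sub>0" "norm (z * cis (- a)) = 1" if "z \<in> C" for z
  proof -
    show n: "norm (z * cis (- a)) = 1" using that by (auto simp: C_def norm_mult)
    show "z * cis (- a) \<notin> \<real>\<^sub>\<le>\<^sub>0"
    proof
      assume "z * cis (- a) \<in> \<real>\<^sub>\<le>\<^sub>0"
      then obtain r where "z * cis (- a) = of_real r" "r \<le> 0" by (auto elim: nonpos_Reals_cases)
      with n have "z * cis (- a) = -1" by simp
      then have "z * cis (- a) * cis a = - cis a" by simp
      then have "z = - cis a" by (simp add: mult.assoc cis_mult)
      with that show False by (simp add: C_def)
    qed
  qed
  show "cis (k z) = z" if "z \<in> C" for z
  proof -
    have "cis (k z) = cis a * cis (Arg (z * cis (- a)))" by (simp add: k_def cis_mult)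
    also have "cis (Arg (z * cis (- a))) = z * cis (- a)"
      using z(2)[OF that] by (metis complex_norm_eq_1_exp_eq cis_conv_exp)
    also have "cis a * (z * cis (- a)) = z" by (simp add: mult.left_commute cis_mult)
    finally show ?thesis .
  qed
  show "k z \<in> {a - pi<..<a + pi}" if "z \<in> C" for z
  proof -
    have "Arg (z * cis (- a)) \<noteq> pi"
      using z(1)[OF that] by (auto simp: Arg_eq_pi complex_nonpos_Reals_iff)
    then show ?thesis using mpi_less_Arg[of "z * cis (- a)"] Arg_le_pi[of "z * cis (- a)"]
      by (simp add: k_def)
  qed
  show k: "k (cis \<theta>) = \<theta>" if "\<theta> \<in> {a - pi<..<a + pi}" for \<theta>
    using that Arg_cis[of "\<theta> - a"] by (simp add: k_def cis_mult)
  show "cis \<theta> \<in> C" if "\<theta> \<in> {a - pi<..<a + pi}" for \<theta>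
  proof -
    have "cis \<theta> \<noteq> - cis a"
    proof
      assume "cis \<theta> = - cis a"
      \<comment> \<open>The omitted point would receive the coordinate \<open>a + pi\<close>,
        because \<open>Arg (-1)\<close> is \<open>pi\<close>, and this endpoint lies outside the
        open interval.\<close>
      then have "k (cis \<theta>) = a + Arg (-1)" by (simp add: k_def cis_mult)
      then show False using k[OF that] that Arg_cis[of pi] by simp
    qed
    then show ?thesis by (simp add: C_def)
  qed
  show "continuous_on C k"
    unfolding k_def by (intro continuous_intros) (use z in auto)
qed

lemma circle_chart_image:
  "(\<lambda>z. a + Arg (z * cis (- a))) ` (sphere 0 1 - {- cis a}) = {a - pi<..<a + pi}"
proof (intro equalityI subsetI)
  fix \<theta> assume "\<theta> \<in> {a - pi<..<a + pi}"
  then show "\<theta> \<in> (\<lambda>z. a + Arg (z * cis (- a))) ` (sphere 0 1 - {- cis a})"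
    using circle_chart(3,4)[of \<theta> a] by (intro image_eqI[of _ _ "cis \<theta>"]) simp_all
qed (use circle_chart(2)[of _ a] in auto)

definition circ_chart :: "real \<Rightarrow> (complex, real) chart" where
  "circ_chart a = (sphere 0 1 - {- cis a}, \<lambda>z. a + Arg (z * cis (- a)))"

lemma atlas_circle: "atlas circle = range circ_chart"
  by (auto simp: circle_def circ_chart_def)

lemma charted_circle: "charted circle"
  unfolding charted_def
proof (intro conjI ballI)
  \<comment> \<open>Every point lies in the chart centred at its own argument, whose omitted point
    is the antipode.\<close>
  have "z \<in> sphere 0 1 - {- cis (Arg z)}" if "z \<in> sphere 0 1" for z :: complex
  proof -
    have "z = cis (Arg z)" using that by (metis complex_norm_eq_1_exp_eq cis_conv_exp dist_0_norm mem_sphere)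
    moreover have "z \<noteq> - z" using that by auto
    ultimately show ?thesis using that by (metis DiffI singletonD)
  qed
  then have "sphere 0 1 \<subseteq> (\<Union>a. fst (circ_chart a))"
    unfolding circ_chart_def fst_conv by blast
  then show "(\<Union>c\<in>atlas circle. fst c) = topspace (mtop circle)"
    unfolding atlas_circle by (auto simp: circle_def circ_chart_def)
  fix c assume "c \<in> atlas circle"
  then obtain a where c: "c = (sphere 0 1 - {- cis a}, \<lambda>z. a + Arg (z * cis (- a)))"
    by (auto simp: circle_def)
  show op: "openin (mtop circle) (fst c)"
    by (simp add: c circle_def openin_delete)
  have im: "snd c ` fst c = {a - pi<..<a + pi}" by (simp only: c fst_conv snd_conv circle_chart_image)
  show "open (snd c ` fst c)" by (simp add: im)
  have "homeomorphic_maps (top_of_set (fst c)) (top_of_set (snd c ` fst c)) (snd c) cis"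
    unfolding homeomorphic_maps_def im
    using circle_chart(1-4)[of _ a] circle_chart(5)[of a]
    by (auto simp: c intro!: continuous_intros)
  then show "homeomorphic_map (subtopology (mtop circle) (fst c)) (top_of_set (snd c ` fst c)) (snd c)"
    unfolding homeomorphic_map_maps
    by (auto simp: circle_def c subtopology_subtopology Int_absorb1 Diff_subset simp del: Int_Diff)
qed

subsection \<open>Tangent maps and pullbacks of 1-forms\<close>

text \<open>Functions agreeing near \<open>x\<close> have the same derivatives there, so the choice
  operator picks the same map, even where no derivative exists.\<close>

lemma frechet_derivative_cong_open:
  assumes "open X" "x \<in> X" "\<And>y. y \<in> X \<Longrightarrow> f y = g y"
  shows "frechet_derivative f (at x) = frechet_derivative g (at x)"
proof -
  have "(f has_derivative D) (at x) \<longleftrightarrow> (g has_derivative D) (at x)" for D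
    using has_derivative_transform_within_open[of f D x UNIV X g]
      has_derivative_transform_within_open[of g D x UNIV X f] assms by auto
  then show ?thesis by (simp add: frechet_derivative_def)
qed

context
  fixes M :: "('a, 'e::euclidean_space) mfd" and c
  assumes M: "charted M" "c \<in> atlas M"
begin

lemma dir_deriv_cong:
  assumes "openin (mtop M) W" "p \<in> W" "p \<in> fst c" "\<And>q. q \<in> W \<Longrightarrow> q \<in> fst c \<Longrightarrow> u q = u' q"
  shows "dir_deriv c v u p = dir_deriv c v u' p"
proof -
  have "open (snd c ` (W \<inter> fst c))"
    using assms(1) charted_openin[OF M] by (intro charted_open_image[OF M]) auto
  then have "frechet_derivative (u \<circ> chart_inv c) (at (snd c p)) =
      frechet_derivative (u' \<circ> chart_inv c) (at (snd c p))"
    by (rule frechet_derivative_cong_open) (use assms M in auto)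
  then show ?thesis by (simp add: dir_deriv_def)
qed

lemma tangent_map_cong:
  assumes "openin (mtop M) W" "p \<in> W" "p \<in> fst c" "\<And>q. q \<in> W \<Longrightarrow> q \<in> fst c \<Longrightarrow> f q = g q"
  shows "tangent_map c d f p = tangent_map c d g p"
proof -
  have "open (snd c ` (W \<inter> fst c))"
    using assms(1) charted_openin[OF M] by (intro charted_open_image[OF M]) auto
  then show ?thesis unfolding tangent_map_def
    by (rule frechet_derivative_cong_open) (use assms M in auto)
qed

lemma tangent_map_id: "p \<in> fst c \<Longrightarrow> tangent_map c c (\<lambda>p. p) p = (\<lambda>v. v)"
proof -
  assume p: "p \<in> fst c"
  have "frechet_derivative (snd c \<circ> (\<lambda>p. p) \<circ> chart_inv c) (at (snd c p)) =
     frechet_derivative (\<lambda>x. x) (at (snd c p))"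
    by (rule frechet_derivative_cong_open[OF charted_open[OF M]]) (use p M in auto)
  then show ?thesis by (simp add: tangent_map_def)
qed

lemma smooth_map_has_derivative:
  assumes "smooth_map M M' S f" "d \<in> atlas M'" "p \<in> S" "p \<in> fst c" "f p \<in> fst d"
  shows "(snd d \<circ> f \<circ> chart_inv c has_derivative tangent_map c d f p) (at (snd c p))"
  unfolding tangent_map_def
  by (rule smooth_on_has_derivative[OF smooth_map_rep[OF assms(1) M(2) assms(2)]]) (use assms in auto)

lemma linear_tangent_map:
  assumes "smooth_map M M' S f" "d \<in> atlas M'" "p \<in> S" "p \<in> fst c" "f p \<in> fst d"
  shows "linear (tangent_map c d f p)"
  using smooth_map_has_derivative[OF assms] has_derivative_linear by blast

lemma tangent_map_compose:
  assumes M': "charted M'" "d \<in> atlas M'" and e: "e \<in> atlas M''"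
    and f: "smooth_map M M' S f" and g: "smooth_map M' M'' T g"
    and p: "p \<in> S" "p \<in> fst c" "f p \<in> fst d" "f p \<in> T" "g (f p) \<in> fst e"
  shows "tangent_map c e (\<lambda>p. g (f p)) p v = tangent_map d e g (f p) (tangent_map c d f p v)"
proof -
  let ?f = "snd d \<circ> f \<circ> chart_inv c" and ?g = "snd e \<circ> g \<circ> chart_inv d"
  have "?f (snd c p) = snd d (f p)" using M p by simp
  then have "((\<lambda>x. ?g (?f x)) has_derivative (\<lambda>v. tangent_map d e g (f p) (tangent_map c d f p v))) (at (snd c p))"
    using has_derivative_compose[OF smooth_map_has_derivative[OF f M'(2) p(1-3)], of ?g]
      smooth_on_has_derivative[OF smooth_map_rep[OF g M'(2) e], of "snd d (f p)"] p
    by (auto simp: tangent_map_def)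
  \<comment> \<open>The composite of representations and the representation of the composite agree
    where \<open>f\<close> stays in the chart \<open>d\<close>, which is an open condition.\<close>
  moreover have "frechet_derivative (\<lambda>x. ?g (?f x)) (at (snd c p)) = tangent_map c e (\<lambda>p. g (f p)) p"
    unfolding tangent_map_def
    by (rule frechet_derivative_cong_open[OF smooth_map_open_domain[OF M f charted_openin[OF M']]])
      (use p M M' in auto)
  ultimately show ?thesis using frechet_derivative_at by metis
qed

end

lemma one_form_linear: "one_form M \<alpha> \<Longrightarrow> c \<in> atlas M \<Longrightarrow> p \<in> fst c \<Longrightarrow> linear (\<alpha> c p)"
  by (simp add: one_form_def)

lemma one_form_smooth:
  "one_form M \<alpha> \<Longrightarrow> c \<in> atlas M \<Longrightarrow> smooth_on (snd c ` fst c) (\<lambda>x. \<alpha> c (chart_inv c x) v)"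
  by (simp add: one_form_def comp_def)

lemma ext_d1_frechet:
  "ext_d1 \<alpha> c p v w =
    frechet_derivative (\<lambda>x. \<alpha> c (chart_inv c x) w) (at (snd c p)) v
  - frechet_derivative (\<lambda>x. \<alpha> c (chart_inv c x) v) (at (snd c p)) w"
  by (simp add: ext_d1_def dir_deriv_def comp_def)

lemma ext_d1_cong:
  assumes "charted M" "c \<in> atlas M" "openin (mtop M) W" "p \<in> W" "p \<in> fst c"
    "\<And>q v. q \<in> W \<Longrightarrow> q \<in> fst c \<Longrightarrow> \<alpha> c q v = \<beta> c q v"
  shows "ext_d1 \<alpha> c p v w = ext_d1 \<beta> c p v w"
proof -
  have "dir_deriv c x (\<lambda>q. \<alpha> c q y) p = dir_deriv c x (\<lambda>q. \<beta> c q y) p" for x y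
    by (rule dir_deriv_cong[OF assms(1-5)]) (use assms(6) in auto)
  then show ?thesis by (simp add: ext_d1_def)
qed

context
  fixes M :: "('a, 'e::euclidean_space) mfd" and M' :: "('b, 'f::euclidean_space) mfd"
    and f S c d \<beta>
  assumes M: "charted M" "c \<in> atlas M" and M': "charted M'" "d \<in> atlas M'"
    and f: "smooth_map M M' S f" and \<beta>: "one_form M' \<beta>"
begin

text \<open>The pulled-back form in one fixed pair of charts, meaningful where \<open>f\<close> maps
  into the domain of \<open>d\<close>. As the source chart is already fixed, it is passed to
  \<open>ext_d1\<close> with a dummy chart argument.\<close>

definition pullback_rep :: "'a \<Rightarrow> 'e \<Rightarrow> real" where
  "pullback_rep p v = \<beta> d (f p) (tangent_map c d f p v)"

private lemma X: "open (snd c ` {p \<in> S \<inter> fst c. f p \<in> fst d})"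
  by (rule smooth_map_open_domain[OF M f charted_openin[OF M']])

private lemma rep_image: "(snd d \<circ> f \<circ> chart_inv c) ` snd c ` {p \<in> S \<inter> fst c. f p \<in> fst d} \<subseteq> snd d ` fst d"
  using M by auto

private lemma form_linear: "y \<in> snd d ` fst d \<Longrightarrow> linear (\<beta> d (chart_inv d y))"
  using one_form_linear[OF \<beta> M'(2)] M' by auto

text \<open>Bridge to the Euclidean lemmas: in coordinates the pullback is the form along the
  representation of \<open>f\<close>, applied to the derivative of that representation.\<close>

private lemma pullback_rep_eq:
  assumes "x \<in> snd c ` {p \<in> S \<inter> fst c. f p \<in> fst d}"
  shows "pullback_rep (chart_inv c x) v =
     \<beta> d (chart_inv d ((snd d \<circ> f \<circ> chart_inv c) x)) (frechet_derivative (snd d \<circ> f \<circ> chart_inv c) (at x) v)"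
  using assms M M' by (auto simp: pullback_rep_def tangent_map_def)

lemma smooth_on_pullback:
  "smooth_on (snd c ` {p \<in> S \<inter> fst c. f p \<in> fst d}) (\<lambda>x. pullback_rep (chart_inv c x) v)"
  by (rule smooth_on_cong[OF X _ smooth_on_form_apply[OF X charted_open[OF M'] smooth_map_rep[OF f M(2) M'(2)]
          rep_image form_linear one_form_smooth[OF \<beta> M'(2)]
          smooth_on_frechet_derivative[OF smooth_map_rep[OF f M(2) M'(2)]]]])
    (use pullback_rep_eq in auto)

lemma ext_d1_pullback:
  assumes p: "p \<in> S" "p \<in> fst c" "f p \<in> fst d"
  shows "ext_d1 (\<lambda>_. pullback_rep) c p v w = ext_d1 \<beta> d (f p) (tangent_map c d f p v) (tangent_map c d f p w)"
proof -
  let ?s = "snd d \<circ> f \<circ> chart_inv c"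
  have x: "snd c p \<in> snd c ` {p \<in> S \<inter> fst c. f p \<in> fst d}" using p by auto
  have sx: "?s (snd c p) = snd d (f p)" using M p by simp
  have *: "frechet_derivative (\<lambda>x. pullback_rep (chart_inv c x) u) (at (snd c p)) =
    frechet_derivative (\<lambda>x. \<beta> d (chart_inv d (?s x)) (frechet_derivative ?s (at x) u)) (at (snd c p))" for u
    by (rule frechet_derivative_cong_open[OF X x]) (rule pullback_rep_eq)
  show ?thesis
    unfolding ext_d1_frechet *
    using exterior_derivative_pullback[OF X charted_open[OF M'] smooth_map_rep[OF f M(2) M'(2)]
          rep_image form_linear one_form_smooth[OF \<beta> M'(2)] x, of w v]
    unfolding sx tangent_map_def .
qed

end

subsection \<open>Connections on principal circle bundles\<close>

lemma cis_Arg_sphere: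
  assumes "z \<in> sphere 0 1"
  shows "cis (Arg z) = z"
proof -
  have "norm z = 1" using assms by simp
  then show ?thesis by (metis complex_norm_eq_1_exp_eq cis_conv_exp)
qed

locale circle_bundle =
  fixes P :: "('p, 'e::euclidean_space) mfd" and N :: "('a, 'f::euclidean_space) mfd"
    and \<pi> :: "'p \<Rightarrow> 'a" and act :: "complex \<Rightarrow> 'p \<Rightarrow> 'p"
  assumes principal: "principal_circle_bundle P N \<pi> act"
begin

lemma manifold_P: "smooth_manifold P" and manifold_N: "smooth_manifold N"
  using principal by (auto simp: principal_circle_bundle_def)

lemma charted_P: "charted P" and charted_N: "charted N"
  using manifold_P manifold_N by (auto intro: smooth_manifold_charted)

lemma smooth_projection: "smooth_map P N (topspace (mtop P)) \<pi>"
  using principal by (auto simp: principal_circle_bundle_def)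

lemma projection_act: "p \<in> topspace (mtop P) \<Longrightarrow> z \<in> sphere 0 1 \<Longrightarrow> \<pi> (act z p) = \<pi> p"
  using principal by (auto simp: principal_circle_bundle_def)

lemma topspace_circle: "topspace (mtop circle) = sphere 0 1"
  by (simp add: circle_def)

text \<open>Joint smoothness of the action is restricted to a slice by composing with the smooth map
  that pairs a point with the constant \<open>z\<close>.\<close>

lemma smooth_act:
  assumes z: "z \<in> sphere 0 1"
  shows "smooth_map P P (topspace (mtop P)) (act z)"
proof -
  have "smooth_map P (mfd_prod circle P) (topspace (mtop P)) (\<lambda>p. (z, p))"
    by (intro smooth_map_Pair smooth_map_const smooth_map_id charted_P charted_circle manifold_P)
      (use z topspace_circle in auto)
  moreover have "smooth_map (mfd_prod circle P) P (sphere 0 1 \<times> topspace (mtop P)) (\<lambda>(z, p). act z p)"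
    using principal by (auto simp: principal_circle_bundle_def)
  ultimately have "smooth_map P P (topspace (mtop P)) (\<lambda>p. (\<lambda>(z, p). act z p) (z, p))"
    by (rule smooth_map_compose[OF charted_P charted_mfd_prod[OF charted_circle charted_P] charted_P])
      (use z in auto)
  then show ?thesis by simp
qed

lemma act_in_topspace: "p \<in> topspace (mtop P) \<Longrightarrow> z \<in> sphere 0 1 \<Longrightarrow> act z p \<in> topspace (mtop P)"
  using smooth_map_in_topspace[OF smooth_act] by blast

text \<open>The trivialization clause of \<open>principal_circle_bundle\<close>, named so that one
  pair \<open>U\<close>, \<open>\<tau>\<close> can be fixed and its properties cited
  separately.\<close>

definition local_triv :: "'a set \<Rightarrow> ('p \<Rightarrow> complex) \<Rightarrow> bool" where
  "local_triv U \<tau> \<longleftrightarrow> (let V = {p \<in> topspace (mtop P). \<pi> p \<in> U}; \<Phi> = (\<lambda>p. (\<pi> p, \<tau> p)) in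
      openin (mtop N) U \<and> bij_betw \<Phi> V (U \<times> sphere 0 1) \<and>
      smooth_map P (mfd_prod N circle) V \<Phi> \<and>
      smooth_map (mfd_prod N circle) P (U \<times> sphere 0 1) (inv_into V \<Phi>) \<and>
      (\<forall>p\<in>V. \<forall>z\<in>sphere 0 1. \<tau> (act z p) = z * \<tau> p))"

lemma ex_local_triv: "x \<in> topspace (mtop N) \<Longrightarrow> \<exists>U \<tau>. x \<in> U \<and> local_triv U \<tau>"
  using principal unfolding principal_circle_bundle_def local_triv_def Let_def by blast

context
  fixes U \<tau> assumes triv: "local_triv U \<tau>"
begin

abbreviation (input) "V \<equiv> {p \<in> topspace (mtop P). \<pi> p \<in> U}"
abbreviation (input) "\<Phi> \<equiv> \<lambda>p. (\<pi> p, \<tau> p)"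
abbreviation (input) "\<Psi> \<equiv> inv_into V \<Phi>"

lemma
  shows triv_openin: "openin (mtop N) U" and triv_bij: "bij_betw \<Phi> V (U \<times> sphere 0 1)"
    and triv_smooth: "smooth_map P (mfd_prod N circle) V \<Phi>"
    and triv_inv_smooth: "smooth_map (mfd_prod N circle) P (U \<times> sphere 0 1) \<Psi>"
    and triv_act: "p \<in> V \<Longrightarrow> z \<in> sphere 0 1 \<Longrightarrow> \<tau> (act z p) = z * \<tau> p"
  using triv by (auto simp: local_triv_def Let_def)

lemma triv_right_inv:
  assumes "x \<in> U" "z \<in> sphere 0 1"
  shows "\<pi> (\<Psi> (x, z)) = x" "\<tau> (\<Psi> (x, z)) = z"
  using bij_betw_inv_into_right[OF triv_bij, of "(x, z)"] assms by auto

lemma triv_left_inv: "p \<in> V \<Longrightarrow> \<Psi> (\<Phi> p) = p"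
  using bij_betw_inv_into_left[OF triv_bij] by blast

lemma triv_in_sphere: "p \<in> V \<Longrightarrow> \<tau> p \<in> sphere 0 1"
  using bij_betw_apply[OF triv_bij] by fastforce

text \<open>Equivariance read through the inverse trivialization: the action is multiplication in
  the circle factor.\<close>

lemma triv_inv_act:
  assumes "p \<in> V" "z \<in> sphere 0 1"
  shows "\<Psi> (\<pi> p, z * \<tau> p) = act z p"
proof -
  have "act z p \<in> V" using assms act_in_topspace projection_act by auto
  from triv_left_inv[OF this] show ?thesis
    using triv_act[OF assms] projection_act assms by auto
qed

lemma triv_transitive:
  assumes "p \<in> V" "q \<in> V" "\<pi> p = \<pi> q"
  shows "\<exists>z\<in>sphere 0 1. q = act z p"
proof (intro bexI)
  \<comment> \<open>The group element is the quotient of the circle coordinates of the two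
    points.\<close>
  show z: "\<tau> q / \<tau> p \<in> sphere 0 1"
    using triv_in_sphere[OF assms(1)] triv_in_sphere[OF assms(2)] by (simp add: norm_divide)
  have "\<tau> p \<noteq> 0" using triv_in_sphere[OF assms(1)] by auto
  then show "q = act (\<tau> q / \<tau> p) p"
    using triv_inv_act[OF assms(1) z] triv_left_inv[OF assms(2)] assms(3) by simp
qed

lemma triv_section: "smooth_map N P U (\<lambda>x. \<Psi> (x, 1))"
  by (rule smooth_map_compose[OF charted_N charted_mfd_prod[OF charted_N charted_circle] charted_P _ triv_inv_smooth])
    (auto intro!: smooth_map_Pair smooth_map_const smooth_map_id charted_N charted_circle manifold_N triv_openin
      simp: topspace_circle)

text \<open>In a trivialization the orbit of \<open>q\<close> moves only in the angle, at unit
  speed, so its velocity is the image of \<open>(0, 1)\<close>. Centring \<open>K\<close> at the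
  angle of \<open>q\<close> places \<open>q\<close> well inside the circle chart.\<close>

lemma fund_field_triv:
  assumes c: "c \<in> atlas N" "\<pi> q \<in> fst c" and d: "d \<in> atlas P" "q \<in> fst d" and q: "q \<in> V"
  defines "K \<equiv> circ_chart (Arg (\<tau> q))"
  shows "fund_field act d q =
     tangent_map (fst c \<times> fst K, map_prod (snd c) (snd K)) d \<Psi> (\<Phi> q) (0, 1)"
proof -
  let ?th = "Arg (\<tau> q)"
  define e where "e = (fst c \<times> fst K, map_prod (snd c) (snd K))"
  define R where "R = snd d \<circ> \<Psi> \<circ> chart_inv e"
  let ?D = "tangent_map e d \<Psi> (\<Phi> q)"
  note prod = charted_mfd_prod[OF charted_N charted_circle]
  have K: "K \<in> atlas circle" by (simp add: atlas_circle K_def)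
  have e: "e \<in> atlas (mfd_prod N circle)"
    unfolding e_def by (rule prod_chart_in_atlas[OF c(1) K])
  have K_cis: "cis t \<in> fst K" "snd K (cis t) = t" if "t \<in> {?th - pi<..<?th + pi}" for t
    using circle_chart(3,4)[OF that] by (simp_all add: K_def circ_chart_def)
  have \<tau>q: "\<tau> q = cis ?th"
    using cis_Arg_sphere[OF triv_in_sphere[OF q]] by simp
  \<comment> \<open>The orbit is a straight line in product coordinates; for \<open>t\<close>
    between \<open>-pi\<close> and \<open>pi\<close> the angle stays within the range of
    \<open>K\<close>.\<close>
  have R_eq: "R (snd c (\<pi> q), ?th + t) = snd d (act (cis t) q)" if "t \<in> {-pi<..<pi}" for t
  proof -
    have t: "?th + t \<in> {?th - pi<..<?th + pi}" using that by simp
    have "(snd c (\<pi> q), ?th + t) = snd e (\<pi> q, cis (?th + t))"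
      using K_cis(2)[OF t] by (simp add: e_def)
    moreover have "(\<pi> q, cis (?th + t)) \<in> fst e" using c K_cis(1)[OF t] by (simp add: e_def)
    moreover have "cis (?th + t) = cis t * \<tau> q" by (subst \<tau>q) (simp add: cis_mult add.commute)
    ultimately show ?thesis
      using triv_inv_act[OF q, of "cis t"] chart_inv[OF prod e] by (simp add: R_def)
  qed
  have \<Phi>q: "\<Phi> q \<in> U \<times> sphere 0 1" using q triv_in_sphere[OF q] by auto
  have "\<Phi> q \<in> fst e" using c K_cis(1)[of ?th] \<tau>q by (simp add: e_def)
  moreover have "snd e (\<Phi> q) = (snd c (\<pi> q), ?th)" using K_cis(2)[of ?th] \<tau>q by (simp add: e_def)
  ultimately have D: "(R has_derivative ?D) (at (snd c (\<pi> q), ?th))"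
    using smooth_map_has_derivative[OF prod e triv_inv_smooth d(1) \<Phi>q] triv_left_inv[OF q] d(2)
    by (simp add: R_def)
  have "((\<lambda>t. (snd c (\<pi> q), ?th + t)) has_derivative (\<lambda>t. (0, t))) (at 0)"
    by (auto intro!: derivative_eq_intros)
  from has_derivative_compose[OF this, of R ?D] D
  have "((\<lambda>t. R (snd c (\<pi> q), ?th + t)) has_derivative (\<lambda>t. ?D (0, t))) (at 0)" by simp
  moreover have "(\<lambda>t. ?D (0, t)) = (\<lambda>t. t *\<^sub>R ?D (0, 1))"
  proof
    show "?D (0, t) = t *\<^sub>R ?D (0, 1)" for t
      using linear_cmul[OF has_derivative_linear[OF D], of t "(0, 1)"] by simp
  qed
  ultimately have "((\<lambda>t. R (snd c (\<pi> q), ?th + t)) has_vector_derivative ?D (0, 1)) (at 0)"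
    unfolding has_vector_derivative_def by (simp only:)
  then have "((\<lambda>t. snd d (act (cis t) q)) has_vector_derivative ?D (0, 1)) (at 0)"
    unfolding has_vector_derivative_def
    by (rule has_derivative_transform_within_open[OF _ open_greaterThanLessThan[of "-pi" pi]]) (use R_eq in auto)
  then show ?thesis unfolding fund_field_def e_def by (rule vector_derivative_at)
qed

text \<open>The base component of the differential of the trivialization is the differential of
  \<open>\<pi>\<close>, so a vertical vector becomes a multiple of \<open>(0, 1)\<close>; the
  inverse trivialization takes this back to a multiple of the fundamental field.\<close>

lemma vertical_fund_field_triv:
  assumes c: "c \<in> atlas N" "\<pi> q \<in> fst c" and d: "d \<in> atlas P" "q \<in> fst d" and q: "q \<in> V"
    and w: "tangent_map d c \<pi> q w = 0"
  shows "\<exists>r. w = r *\<^sub>R fund_field act d q"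
proof -
  define K where "K = circ_chart (Arg (\<tau> q))"
  define e where "e = (fst c \<times> fst K, map_prod (snd c) (snd K))"
  note prod = charted_mfd_prod[OF charted_N charted_circle]
  have "K \<in> atlas circle" by (simp add: atlas_circle K_def)
  then have e: "e \<in> atlas (mfd_prod N circle)"
    unfolding e_def by (rule prod_chart_in_atlas[OF c(1)])
  have \<tau>q: "\<tau> q = cis (Arg (\<tau> q))"
    using cis_Arg_sphere[OF triv_in_sphere[OF q]] by simp
  have "cis (Arg (\<tau> q)) \<in> fst K"
    using circle_chart(3)[of "Arg (\<tau> q)" "Arg (\<tau> q)"] by (simp add: K_def circ_chart_def)
  then have \<Phi>e: "\<Phi> q \<in> fst e" using c \<tau>q by (simp add: e_def)
  have \<Phi>q: "\<Phi> q \<in> U \<times> sphere 0 1" using q triv_in_sphere[OF q] by auto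
  have V: "openin (mtop P) V" using triv_smooth by (simp add: smooth_map_def)
  let ?D\<Phi> = "tangent_map d e \<Phi> q" and ?D\<Psi> = "tangent_map e d \<Psi> (\<Phi> q)"
  \<comment> \<open>Differentiating \<open>\<Psi> \<circ> \<Phi> = id\<close> on the open set
    \<open>V\<close> recovers \<open>w\<close> from its image.\<close>
  have "tangent_map d d (\<lambda>p. \<Psi> (\<Phi> p)) q = tangent_map d d (\<lambda>p. p) q"
    by (rule tangent_map_cong[OF charted_P d(1) V q d(2)]) (rule triv_left_inv)
  then have "tangent_map d d (\<lambda>p. \<Psi> (\<Phi> p)) q w = w"
    using tangent_map_id[OF charted_P d] by simp
  then have w_eq: "w = ?D\<Psi> (?D\<Phi> w)"
    using tangent_map_compose[OF charted_P d(1) prod e d(1) triv_smooth triv_inv_smooth q d(2) \<Phi>e \<Phi>q]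
      triv_left_inv[OF q] d(2) by simp
  have "((\<lambda>x. fst ((snd e \<circ> \<Phi> \<circ> chart_inv d) x)) has_derivative (\<lambda>w. fst (?D\<Phi> w))) (at (snd d q))"
    by (rule has_derivative_fst[OF smooth_map_has_derivative[OF charted_P d(1) triv_smooth e q d(2) \<Phi>e]])
  moreover have "(\<lambda>x. fst ((snd e \<circ> \<Phi> \<circ> chart_inv d) x)) = snd c \<circ> \<pi> \<circ> chart_inv d"
    by (auto simp: e_def)
  ultimately have "(snd c \<circ> \<pi> \<circ> chart_inv d has_derivative (\<lambda>w. fst (?D\<Phi> w))) (at (snd d q))"
    by (simp only:)
  from fun_cong[OF frechet_derivative_at[OF this], of w]
  have "fst (?D\<Phi> w) = tangent_map d c \<pi> q w" unfolding tangent_map_def .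
  with w have "fst (?D\<Phi> w) = 0" by (simp only:)
  then have D\<Phi>w: "?D\<Phi> w = snd (?D\<Phi> w) *\<^sub>R (0, 1)" by (simp add: prod_eq_iff)
  have "linear ?D\<Psi>"
    by (rule linear_tangent_map[OF prod e triv_inv_smooth d(1) \<Phi>q \<Phi>e]) (simp add: triv_left_inv[OF q] d(2))
  then have "?D\<Psi> (snd (?D\<Phi> w) *\<^sub>R (0, 1)) = snd (?D\<Phi> w) *\<^sub>R ?D\<Psi> (0, 1)"
    by (rule linear_cmul)
  moreover have "fund_field act d q = ?D\<Psi> (0, 1)"
    unfolding e_def K_def by (rule fund_field_triv[OF c d q])
  ultimately have "w = snd (?D\<Phi> w) *\<^sub>R fund_field act d q"
    using w_eq unfolding D\<Phi>w[symmetric] by (simp only:)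
  then show ?thesis by (rule exI)
qed

end


lemma fibre_transitive:
  assumes "p \<in> topspace (mtop P)" "q \<in> topspace (mtop P)" "\<pi> p = \<pi> q"
  shows "\<exists>z\<in>sphere 0 1. q = act z p"
proof -
  obtain U \<tau> where "\<pi> p \<in> U" "local_triv U \<tau>"
    using ex_local_triv[OF smooth_map_in_topspace[OF smooth_projection assms(1)]] by blast
  then show ?thesis using triv_transitive[of U \<tau> p q] assms by simp
qed

lemma vertical_fund_field:
  assumes c: "c \<in> atlas N" "\<pi> q \<in> fst c" and d: "d \<in> atlas P" "q \<in> fst d"
    and w: "tangent_map d c \<pi> q w = 0"
  shows "\<exists>r. w = r *\<^sub>R fund_field act d q"
proof -
  have q: "q \<in> topspace (mtop P)" by (rule charted_topspace[OF charted_P d])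
  obtain U \<tau> where "\<pi> q \<in> U" "local_triv U \<tau>"
    using ex_local_triv[OF smooth_map_in_topspace[OF smooth_projection q]] by blast
  then show ?thesis using vertical_fund_field_triv[of U \<tau>, OF _ c d _ w] q by simp
qed

lemma local_section:
  assumes c: "c \<in> atlas N" "p \<in> fst c"
  obtains U s d where "openin (mtop N) U" "p \<in> U" "smooth_map N P U s" "\<And>x. x \<in> U \<Longrightarrow> \<pi> (s x) = x"
    "d \<in> atlas P" "s p \<in> fst d"
proof -
  obtain U \<tau> where U: "p \<in> U" and triv: "local_triv U \<tau>"
    using ex_local_triv[OF charted_topspace[OF charted_N c]] by blast
  let ?s = "\<lambda>x. inv_into {p \<in> topspace (mtop P). \<pi> p \<in> U} (\<lambda>p. (\<pi> p, \<tau> p)) (x, 1)"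
  have s: "smooth_map N P U ?s" by (rule triv_section[OF triv])
  obtain d where "d \<in> atlas P" "?s p \<in> fst d"
    using charted_cover[OF charted_P smooth_map_in_topspace[OF s U]] by blast
  then show thesis
    using that[OF triv_openin[OF triv] U s] triv_right_inv(1)[OF triv] by simp
qed

text \<open>Differentiate the identity \<open>\<pi> (s x) = x\<close>: a section provides a lift of
  every base vector.\<close>

lemma tangent_map_section:
  assumes c: "c \<in> atlas N" "p \<in> fst c" and d: "d \<in> atlas P" "s p \<in> fst d"
    and U: "openin (mtop N) U" "p \<in> U" and s: "smooth_map N P U s" "\<And>x. x \<in> U \<Longrightarrow> \<pi> (s x) = x"
  shows "tangent_map d c \<pi> (s p) (tangent_map c d s p v) = v"
proof -
  have "tangent_map c c (\<lambda>x. \<pi> (s x)) p = tangent_map c c (\<lambda>x. x) p"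
    by (rule tangent_map_cong[OF charted_N c(1) U c(2)]) (rule s(2))
  moreover have "tangent_map c c (\<lambda>x. \<pi> (s x)) p v = tangent_map d c \<pi> (s p) (tangent_map c d s p v)"
    by (rule tangent_map_compose[OF charted_N c(1) charted_P d(1) c(1) s(1) smooth_projection U(2) c(2) d(2)])
      (use charted_topspace[OF charted_P d] s(2)[OF U(2)] c(2) in auto)
  ultimately show ?thesis using tangent_map_id[OF charted_N c] by simp
qed

text \<open>The pullback condition defining \<open>F\<close> is evaluated at \<open>s p\<close> on
  the lifts given by the section, which project back to \<open>v\<close> and
  \<open>w\<close>.\<close>

lemma curvature_form_section:
  assumes F: "curvature_form P N \<pi> \<eta> F"
    and c: "c \<in> atlas N" "p \<in> fst c" and d: "d \<in> atlas P" "s p \<in> fst d"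
    and U: "openin (mtop N) U" "p \<in> U" and s: "smooth_map N P U s" "\<And>x. x \<in> U \<Longrightarrow> \<pi> (s x) = x"
  shows "F c p v w = ext_d1 \<eta> d (s p) (tangent_map c d s p v) (tangent_map c d s p w)"
proof -
  have "\<pi> (s p) = p" using s(2)[OF U(2)] .
  then show ?thesis
    using F c d tangent_map_section[OF c d U s] by (simp add: curvature_form_def is_pullback2_def)
qed

lemma curvature_form_closed:
  assumes \<eta>: "one_form P \<eta>" and F: "curvature_form P N \<pi> \<eta> F"
  shows "closed_2form N F"
  unfolding closed_2form_def
proof (intro conjI ballI allI)
  show "two_form N F" using F by (simp add: curvature_form_def)
  fix c p u v w assume c: "c \<in> atlas N" and p: "p \<in> fst c"
  obtain U s d where U: "openin (mtop N) U" "p \<in> U" and s: "smooth_map N P U s" "\<And>x. x \<in> U \<Longrightarrow> \<pi> (s x) = x"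
    and d: "d \<in> atlas P" "s p \<in> fst d"
    by (rule local_section[OF c p]) blast
  let ?W = "{q \<in> U. s q \<in> fst d}" and ?X = "snd c ` {q \<in> U \<inter> fst c. s q \<in> fst d}"
  let ?A = "\<lambda>x. pullback_rep s c d \<eta> (chart_inv c x)"
  have W: "openin (mtop N) ?W"
    by (rule smooth_map_openin_preimage[OF s(1) charted_openin[OF charted_P d(1)]])
  have X: "open ?X" "snd c p \<in> ?X"
    using smooth_map_open_domain[OF charted_N c s(1) charted_openin[OF charted_P d(1)]] U d p by auto
  \<comment> \<open>The identity holds on an open set around \<open>p\<close>, hence may be used
    under a further derivative.\<close>
  have F_eq: "F c q v w = ext_d1 (\<lambda>_. pullback_rep s c d \<eta>) c q v w" if "q \<in> ?W" "q \<in> fst c" for q v w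
    using curvature_form_section[OF F c that(2) d(1) _ U(1) _ s]
      ext_d1_pullback[OF charted_N c charted_P d(1) s(1) \<eta> _ that(2)] that by simp
  have "dir_deriv c u (\<lambda>q. F c q v w) p = frechet_derivative (\<lambda>y. frechet_derivative (\<lambda>y. ?A y w) (at y) v
      - frechet_derivative (\<lambda>y. ?A y v) (at y) w) (at (snd c p)) u" for u v w
  proof -
    have "dir_deriv c u (\<lambda>q. F c q v w) p = dir_deriv c u (\<lambda>q. ext_d1 (\<lambda>_. pullback_rep s c d \<eta>) c q v w) p"
      by (rule dir_deriv_cong[OF charted_N c W _ p]) (use U d F_eq in auto)
    also have "\<dots> = frechet_derivative (\<lambda>y. frechet_derivative (\<lambda>y. ?A y w) (at y) v
      - frechet_derivative (\<lambda>y. ?A y v) (at y) w) (at (snd c p)) u"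
      unfolding dir_deriv_def comp_def ext_d1_frechet
      by (rule fun_cong[OF frechet_derivative_cong_open[OF X]]) (use charted_N c in auto)
    finally show ?thesis .
  qed
  then show "ext_d2 F c p u v w = 0"
    unfolding ext_d2_def
    using exterior_derivative_twice[OF X, where A = ?A and u = u and v = v and w = w]
      smooth_on_pullback[OF charted_N c charted_P d(1) s(1) \<eta>] by simp
qed

end

section \<open>Descent of invariant horizontal 1-forms to the base\<close>

locale basic_form = circle_bundle P N \<pi> act
  for P :: "('p, 'e::euclidean_space) mfd" and N :: "('a, 'f::euclidean_space) mfd"
    and \<pi> :: "'p \<Rightarrow> 'a" and act :: "complex \<Rightarrow> 'p \<Rightarrow> 'p" +
  fixes \<beta> :: "('p, 'e) cov1"
  assumes form: "one_form P \<beta>"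
    and invariant: "\<And>z. z \<in> sphere 0 1 \<Longrightarrow> is_pullback1 P P (act z) \<beta> \<beta>"
    and horizontal: "\<And>d q. d \<in> atlas P \<Longrightarrow> q \<in> fst d \<Longrightarrow> \<beta> d q (fund_field act d q) = 0"
begin

text \<open>The value on \<open>v\<close> is that of \<open>\<beta>\<close> on some lift of
  \<open>v\<close> at some point of the fibre. The choice is harmless by
  \<open>lift_independent\<close>, and local sections supply a lift.\<close>

definition descent :: "('a, 'f) cov1" where
  "descent c p v = (SOME r. \<exists>d q w. d \<in> atlas P \<and> q \<in> fst d \<and> \<pi> q = p \<and>
     tangent_map d c \<pi> q w = v \<and> r = \<beta> d q w)"

text \<open>A group element moves \<open>q\<close> to \<open>q'\<close>, and invariance transports
  \<open>w\<close> to a vector \<open>w''\<close> there. The difference of \<open>w'\<close> and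
  \<open>w''\<close> is vertical, hence a multiple of the fundamental field, on which
  \<open>\<beta>\<close> vanishes.\<close>

lemma lift_independent:
  assumes c: "c \<in> atlas N" "\<pi> q \<in> fst c" and d: "d \<in> atlas P" "q \<in> fst d"
    and d': "d' \<in> atlas P" "q' \<in> fst d'" and q': "\<pi> q' = \<pi> q"
    and w: "tangent_map d c \<pi> q w = tangent_map d' c \<pi> q' w'"
  shows "\<beta> d q w = \<beta> d' q' w'"
proof -
  have q_in: "q \<in> topspace (mtop P)" "q' \<in> topspace (mtop P)"
    using charted_topspace[OF charted_P] d d' by blast+
  obtain z where z: "z \<in> sphere 0 1" "q' = act z q"
    using fibre_transitive[OF q_in] q' by auto
  define w'' where "w'' = tangent_map d d' (act z) q w"
  have 1: "\<beta> d q w = \<beta> d' q' w''"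
    using invariant[OF z(1)] d d' z(2) by (auto simp: is_pullback1_def w''_def)
  \<comment> \<open>Since the action preserves fibres, transporting \<open>w\<close> does not change
    its projection to the base.\<close>
  have "tangent_map d c (\<lambda>q. \<pi> (act z q)) q = tangent_map d c \<pi> q"
    by (rule tangent_map_cong[OF charted_P d(1) openin_topspace q_in(1) d(2)])
      (rule projection_act[OF _ z(1)])
  moreover have "tangent_map d c (\<lambda>q. \<pi> (act z q)) q w = tangent_map d' c \<pi> q' w''"
    using tangent_map_compose[OF charted_P d(1) charted_P d'(1) c(1) smooth_act[OF z(1)] smooth_projection
        q_in(1) d(2), of w] d' q_in c q' unfolding w''_def z(2) by simp
  ultimately have w'': "tangent_map d' c \<pi> q' w' = tangent_map d' c \<pi> q' w''" using w by simp
  have lin: "linear (tangent_map d' c \<pi> q')"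
    by (rule linear_tangent_map[OF charted_P d'(1) smooth_projection c(1) q_in(2) d'(2)]) (use c q' in simp)
  have "tangent_map d' c \<pi> q' (w' - w'') = 0"
    using linear_diff[OF lin] w'' by simp
  then obtain r where r: "w' - w'' = r *\<^sub>R fund_field act d' q'"
    using vertical_fund_field[OF c(1) _ d'] c q' by auto
  have lin\<beta>: "linear (\<beta> d' q')" by (rule one_form_linear[OF form d'])
  have "\<beta> d' q' (w' - w'') = 0"
    unfolding r using linear_cmul[OF lin\<beta>] horizontal[OF d'] by simp
  then show ?thesis using 1 linear_diff[OF lin\<beta>, of w' w''] by simp
qed

text \<open>This is the relation that \<open>\<beta>\<close> is the pullback of
  \<open>descent\<close> along \<open>\<pi>\<close>; independence of the lift evaluates the choice
  operator.\<close>

lemma descent_eq: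
  assumes c: "c \<in> atlas N" "\<pi> q \<in> fst c" and d: "d \<in> atlas P" "q \<in> fst d"
  shows "descent c (\<pi> q) (tangent_map d c \<pi> q w) = \<beta> d q w"
  unfolding descent_def
proof (rule someI2)
  show "\<exists>d' q' w'. d' \<in> atlas P \<and> q' \<in> fst d' \<and> \<pi> q' = \<pi> q \<and>
     tangent_map d' c \<pi> q' w' = tangent_map d c \<pi> q w \<and> \<beta> d q w = \<beta> d' q' w'"
    using d by blast
next
  fix r assume "\<exists>d' q' w'. d' \<in> atlas P \<and> q' \<in> fst d' \<and> \<pi> q' = \<pi> q \<and>
     tangent_map d' c \<pi> q' w' = tangent_map d c \<pi> q w \<and> r = \<beta> d' q' w'"
  then obtain d' q' w' where *: "d' \<in> atlas P" "q' \<in> fst d'" "\<pi> q' = \<pi> q"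
     "tangent_map d' c \<pi> q' w' = tangent_map d c \<pi> q w" "r = \<beta> d' q' w'" by blast
  show "r = \<beta> d q w"
    unfolding *(5) by (rule lift_independent[OF c d *(1,2,3) *(4)[symmetric], symmetric])
qed

lemma descent_section:
  assumes c: "c \<in> atlas N" "p \<in> fst c" and d: "d \<in> atlas P" "s p \<in> fst d"
    and U: "openin (mtop N) U" "p \<in> U" and s: "smooth_map N P U s" "\<And>x. x \<in> U \<Longrightarrow> \<pi> (s x) = x"
  shows "descent c p v = pullback_rep s c d \<beta> p v"
proof -
  have "\<pi> (s p) = p" using s(2)[OF U(2)] .
  then show ?thesis
    using descent_eq[OF c(1) _ d, of "tangent_map c d s p v"] c tangent_map_section[OF c d U s]
    by (simp add: pullback_rep_def[OF charted_N c(1) charted_P d(1) s(1) form])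
qed

text \<open>Linearity and smoothness are inherited from the pullback along a section near each
  point. For the change of chart, one lift serves both charts of the base.\<close>

lemma one_form_descent: "one_form N descent"
  unfolding one_form_def
proof (intro conjI ballI allI)
  fix c p assume c: "c \<in> atlas N" and p: "p \<in> fst c"
  obtain U s d where U: "openin (mtop N) U" "p \<in> U" and s: "smooth_map N P U s" "\<And>x. x \<in> U \<Longrightarrow> \<pi> (s x) = x"
    and d: "d \<in> atlas P" "s p \<in> fst d"
    by (rule local_section[OF c p]) blast
  have "descent c p = (\<lambda>v. \<beta> d (s p) (tangent_map c d s p v))"
    using descent_section[OF c p d U s] pullback_rep_def[OF charted_N c charted_P d(1) s(1) form] by auto
  then show "linear (descent c p)"
    using linear_compose[OF linear_tangent_map[OF charted_N c s(1) d(1) U(2) p d(2)] one_form_linear[OF form d]]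
    by (simp add: comp_def)
next
  fix c v assume c: "c \<in> atlas N"
  show "smooth_on (snd c ` fst c) ((\<lambda>p. descent c p v) \<circ> chart_inv c)"
  proof (rule smooth_on_local)
    fix x assume "x \<in> snd c ` fst c"
    then obtain p where p: "p \<in> fst c" "x = snd c p" by auto
    obtain U s d where U: "openin (mtop N) U" "p \<in> U" and s: "smooth_map N P U s" "\<And>x. x \<in> U \<Longrightarrow> \<pi> (s x) = x"
      and d: "d \<in> atlas P" "s p \<in> fst d"
      by (rule local_section[OF c p(1)]) blast
    show "\<exists>X. open X \<and> x \<in> X \<and> smooth_on X ((\<lambda>p. descent c p v) \<circ> chart_inv c)"
    proof (intro exI conjI)
      let ?X = "snd c ` {q \<in> U \<inter> fst c. s q \<in> fst d}"
      show X: "open ?X"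
        by (rule smooth_map_open_domain[OF charted_N c s(1) charted_openin[OF charted_P d(1)]])
      show "x \<in> ?X" using p U d by auto
      have "descent c q v = pullback_rep s c d \<beta> q v" if "q \<in> U" "q \<in> fst c" "s q \<in> fst d" for q
        by (rule descent_section[OF c that(2) d(1) that(3) U(1) that(1) s])
      then show "smooth_on ?X ((\<lambda>p. descent c p v) \<circ> chart_inv c)"
        by (intro smooth_on_cong[OF X _ smooth_on_pullback[OF charted_N c charted_P d(1) s(1) form, of v]])
          (use charted_N c in auto)
    qed
  qed
next
  show "is_pullback1 N N (\<lambda>p. p) descent descent"
    unfolding is_pullback1_def
  proof (intro ballI impI allI)
    fix c c' p v assume c: "c \<in> atlas N" and p: "p \<in> fst c" and c': "c' \<in> atlas N" "p \<in> fst c'"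
    obtain U s d where U: "openin (mtop N) U" "p \<in> U" and s: "smooth_map N P U s" "\<And>x. x \<in> U \<Longrightarrow> \<pi> (s x) = x"
      and d: "d \<in> atlas P" "s p \<in> fst d"
      by (rule local_section[OF c p]) blast
    define w where "w = tangent_map c d s p v"
    have v: "tangent_map d c \<pi> (s p) w = v"
      unfolding w_def by (rule tangent_map_section[OF c p d U s])
    have sp: "\<pi> (s p) = p" using s(2)[OF U(2)] .
    \<comment> \<open>Projecting the lift \<open>w\<close> directly in the chart \<open>c'\<close>
      is the same as projecting it in \<open>c\<close>, where it gives \<open>v\<close>, and then
      changing coordinates.\<close>
    have "tangent_map d c' (\<lambda>q. \<pi> q) (s p) w = tangent_map c c' (\<lambda>p. p) p v"
      using tangent_map_compose[OF charted_P d(1) charted_N c c'(1) smooth_projection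
          smooth_map_id[OF manifold_N openin_topspace] charted_topspace[OF charted_P d] d(2), of w]
        sp p c' v charted_topspace[OF charted_N c p] by simp
    then show "descent c p v = descent c' p (tangent_map c c' (\<lambda>p. p) p v)"
      using descent_eq[OF c _ d, of w] descent_eq[OF c'(1) _ d, of w] sp p c' v by simp
  qed
qed

text \<open>Near \<open>p\<close> the descended form is the pullback of \<open>\<beta>\<close> along
  \<open>s\<close>, and the exterior derivative commutes with that pullback.\<close>

lemma ext_d1_descent:
  assumes c: "c \<in> atlas N" "p \<in> fst c" and d: "d \<in> atlas P" "s p \<in> fst d"
    and U: "openin (mtop N) U" "p \<in> U" and s: "smooth_map N P U s" "\<And>x. x \<in> U \<Longrightarrow> \<pi> (s x) = x"
  shows "ext_d1 descent c p v w = ext_d1 \<beta> d (s p) (tangent_map c d s p v) (tangent_map c d s p w)"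
proof -
  let ?W = "{q \<in> U. s q \<in> fst d}"
  have W: "openin (mtop N) ?W"
    by (rule smooth_map_openin_preimage[OF s(1) charted_openin[OF charted_P d(1)]])
  have "ext_d1 descent c p v w = ext_d1 (\<lambda>_. pullback_rep s c d \<beta>) c p v w"
    by (rule ext_d1_cong[OF charted_N c(1) W _ c(2)])
      (use U d descent_section[OF c(1) _ d(1) _ U(1) _ s] in auto)
  then show ?thesis
    using ext_d1_pullback[OF charted_N c(1) charted_P d(1) s(1) form U(2) c(2) d(2)] by simp
qed

end

section \<open>Comparing the curvature classes of two connections\<close>

lemma one_form_diff:
  assumes M: "charted M" and "one_form M \<alpha>" "one_form M \<beta>"
  shows "one_form M (\<lambda>c p v. \<alpha> c p v - \<beta> c p v)"
  unfolding one_form_def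
proof (intro conjI ballI allI)
  show "linear (\<lambda>v. \<alpha> c p v - \<beta> c p v)" if "c \<in> atlas M" "p \<in> fst c" for c p
    by (rule linear_compose_sub[OF one_form_linear[OF assms(2) that] one_form_linear[OF assms(3) that]])
  show "smooth_on (snd c ` fst c) ((\<lambda>p. \<alpha> c p v - \<beta> c p v) \<circ> chart_inv c)" if "c \<in> atlas M" for c v
    unfolding comp_def
    by (rule smooth_on_diff[OF charted_open[OF M that] one_form_smooth[OF assms(2) that] one_form_smooth[OF assms(3) that]])
  show "is_pullback1 M M (\<lambda>p. p) (\<lambda>c p v. \<alpha> c p v - \<beta> c p v) (\<lambda>c p v. \<alpha> c p v - \<beta> c p v)"
    using assms(2,3) unfolding one_form_def is_pullback1_def
    by (intro ballI impI allI arg_cong2[where f = "(-)"]) blast+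
qed

lemma ext_d1_diff:
  assumes M: "charted M" and "one_form M \<alpha>" "one_form M \<beta>" and c: "c \<in> atlas M" "p \<in> fst c"
  shows "ext_d1 (\<lambda>c p v. \<alpha> c p v - \<beta> c p v) c p v w = ext_d1 \<alpha> c p v w - ext_d1 \<beta> c p v w"
proof -
  have *: "(\<lambda>x. \<alpha> c (chart_inv c x) u) differentiable (at (snd c p))"
       "(\<lambda>x. \<beta> c (chart_inv c x) u) differentiable (at (snd c p))" for u
    using smooth_on_differentiable[OF one_form_smooth[OF assms(2) c(1)]]
      smooth_on_differentiable[OF one_form_smooth[OF assms(3) c(1)]] c by auto
  show ?thesis unfolding ext_d1_frechet frechet_derivative_diff[OF *] by simp
qed

context circle_bundle
begin

lemma curvature_forms_cohomologous:
  assumes "connection_form P act \<eta>" "connection_form P act \<eta>'"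
    and F: "curvature_form P N \<pi> \<eta> F" "curvature_form P N \<pi> \<eta>' F'"
  shows "\<exists>\<alpha>. one_form N \<alpha> \<and> (\<forall>c\<in>atlas N. \<forall>p\<in>fst c. \<forall>v w. F c p v w - F' c p v w = ext_d1 \<alpha> c p v w)"
proof -
  have \<eta>: "one_form P \<eta>" "one_form P \<eta>'" using assms by (simp_all add: connection_form_def)
  interpret basic_form P N \<pi> act "\<lambda>d q w. \<eta> d q w - \<eta>' d q w"
  proof
    show "one_form P (\<lambda>d q w. \<eta> d q w - \<eta>' d q w)" by (rule one_form_diff[OF charted_P \<eta>])
    show "is_pullback1 P P (act z) (\<lambda>d q w. \<eta> d q w - \<eta>' d q w) (\<lambda>d q w. \<eta> d q w - \<eta>' d q w)"
      if "z \<in> sphere 0 1" for z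
      using assms(1,2) that unfolding connection_form_def is_pullback1_def
      by (intro ballI impI allI arg_cong2[where f = "(-)"]) blast+
  qed (use assms(1,2) in \<open>simp add: connection_form_def\<close>)
  show ?thesis
  proof (intro exI conjI ballI allI)
    show "one_form N descent" by (rule one_form_descent)
    fix c p v w assume c: "c \<in> atlas N" "p \<in> fst c"
    obtain U s d where U: "openin (mtop N) U" "p \<in> U" and s: "smooth_map N P U s" "\<And>x. x \<in> U \<Longrightarrow> \<pi> (s x) = x"
      and d: "d \<in> atlas P" "s p \<in> fst d"
      by (rule local_section[OF c]) blast
    have "ext_d1 descent c p v w = ext_d1 (\<lambda>d q w. \<eta> d q w - \<eta>' d q w) d (s p)
        (tangent_map c d s p v) (tangent_map c d s p w)"
      by (rule ext_d1_descent[OF c d U s])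
    then show "F c p v w - F' c p v w = ext_d1 descent c p v w"
      using curvature_form_section[OF F(1) c d U s] curvature_form_section[OF F(2) c d U s]
        ext_d1_diff[OF charted_P \<eta> d] by simp
  qed
qed

text \<open>If \<open>\<omega> - F\<close> and \<open>F' - F\<close> are exact, subtracting their
  primitives gives one for \<open>\<omega> - F'\<close>. The hypotheses are symmetric in the two
  connections, so this inclusion yields equality of the classes.\<close>

lemma de_rham_class_curvature_le:
  assumes "connection_form P act \<eta>" "connection_form P act \<eta>'"
    and F: "curvature_form P N \<pi> \<eta> F" "curvature_form P N \<pi> \<eta>' F'"
  shows "de_rham_class2 N F \<subseteq> de_rham_class2 N F'"
proof
  fix \<omega> assume "\<omega> \<in> de_rham_class2 N F"
  then obtain \<alpha> where \<omega>: "closed_2form N \<omega>" and \<alpha>: "one_form N \<alpha>"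
    "\<And>c p v w. c \<in> atlas N \<Longrightarrow> p \<in> fst c \<Longrightarrow> \<omega> c p v w - F c p v w = ext_d1 \<alpha> c p v w"
    by (auto simp: de_rham_class2_def)
  obtain \<beta> where \<beta>: "one_form N \<beta>"
    "\<And>c p v w. c \<in> atlas N \<Longrightarrow> p \<in> fst c \<Longrightarrow> F' c p v w - F c p v w = ext_d1 \<beta> c p v w"
    using curvature_forms_cohomologous[OF assms(2,1) F(2,1)] by auto
  have "\<omega> c p v w - F' c p v w = ext_d1 (\<lambda>c p v. \<alpha> c p v - \<beta> c p v) c p v w"
    if "c \<in> atlas N" "p \<in> fst c" for c p v w
    using \<alpha>(2)[OF that] \<beta>(2)[OF that] ext_d1_diff[OF charted_N \<alpha>(1) \<beta>(1) that] by smt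
  then show "\<omega> \<in> de_rham_class2 N F'"
    using \<omega> one_form_diff[OF charted_N \<alpha>(1) \<beta>(1)] unfolding de_rham_class2_def by blast
qed

end

subsection \<open>Positive definite matrices and the volume form\<close>

lemma matrix_inv_inverse:
  assumes "invertible A"
  shows "A ** matrix_inv A = mat 1" "matrix_inv A ** A = mat 1"
proof -
  have "\<exists>A'. A ** A' = mat 1 \<and> A' ** A = mat 1" using assms by (simp add: invertible_def)
  from someI_ex[OF this] show "A ** matrix_inv A = mat 1" "matrix_inv A ** A = mat 1"
    by (simp_all add: matrix_inv_def)
qed

text \<open>Differentiating the Leibniz formula replaces one row of \<open>A t\<close> at a time by
  the corresponding row of \<open>A'\<close>; Cramer's rule then evaluates each of these
  determinants.\<close>

lemma has_real_derivative_det: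
  fixes A :: "real \<Rightarrow> real^'n^'n" and A' :: "real^'n^'n"
  assumes A: "\<And>i j. ((\<lambda>s. A s $ i $ j) has_real_derivative A' $ i $ j) (at t within I)"
    and inv: "invertible (A t)"
  shows "((\<lambda>s. det (A s)) has_real_derivative
    (\<Sum>i\<in>UNIV. \<Sum>j\<in>UNIV. A' $ i $ j * matrix_inv (A t) $ j $ i) * det (A t)) (at t within I)"
proof -
  let ?S = "{p. p permutes (UNIV :: 'n set)}"
  let ?R = "\<lambda>k. (\<chi> i. if i = k then A' $ i else A t $ i)"
  \<comment> \<open>Each term of the product rule for a Leibniz monomial is the same monomial of the
    matrix \<open>?R k\<close>, which has the derivative in row \<open>k\<close>.\<close>
  have prod_upd: "A' $ k $ p k * (\<Prod>j\<in>UNIV - {k}. A t $ j $ p j) = (\<Prod>i\<in>UNIV. ?R k $ i $ p i)" for k p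
  proof -
    have "(\<Prod>i\<in>UNIV. ?R k $ i $ p i) = ?R k $ k $ p k * (\<Prod>i\<in>UNIV - {k}. ?R k $ i $ p i)"
      by (rule prod.remove) auto
    then show ?thesis by simp
  qed
  have "((\<lambda>s. \<Prod>i\<in>UNIV. A s $ i $ p i) has_real_derivative (\<Sum>k\<in>UNIV. \<Prod>i\<in>UNIV. ?R k $ i $ p i)) (at t within I)"
    for p
  proof -
    have "((\<lambda>s. \<Prod>i\<in>UNIV. A s $ i $ p i) has_derivative
        (\<lambda>y. \<Sum>k\<in>UNIV. A' $ k $ p k * y * (\<Prod>j\<in>UNIV - {k}. A t $ j $ p j))) (at t within I)"
      by (rule has_derivative_prod) (rule A[unfolded has_field_derivative_def])
    moreover have "(\<lambda>y. \<Sum>k\<in>UNIV. A' $ k $ p k * y * (\<Prod>j\<in>UNIV - {k}. A t $ j $ p j)) =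
        (*) (\<Sum>k\<in>UNIV. \<Prod>i\<in>UNIV. ?R k $ i $ p i)"
      unfolding prod_upd[symmetric] by (rule ext) (simp add: sum_distrib_left sum_distrib_right mult_ac)
    ultimately show ?thesis by (simp add: has_field_derivative_def)
  qed
  then have "((\<lambda>s. \<Sum>p\<in>?S. of_int (sign p) * (\<Prod>i\<in>UNIV. A s $ i $ p i)) has_real_derivative
      (\<Sum>p\<in>?S. of_int (sign p) * (\<Sum>k\<in>UNIV. \<Prod>i\<in>UNIV. ?R k $ i $ p i))) (at t within I)"
    by (intro DERIV_sum DERIV_cmult)
  moreover have "(\<Sum>p\<in>?S. of_int (sign p) * (\<Sum>k\<in>UNIV. \<Prod>i\<in>UNIV. ?R k $ i $ p i)) = (\<Sum>k\<in>UNIV. det (?R k))"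
    unfolding det_def sum_distrib_left by (rule sum.swap)
  moreover have "det (?R k) = (\<Sum>j\<in>UNIV. A' $ k $ j * matrix_inv (A t) $ j $ k) * det (A t)" for k
  proof -
    \<comment> \<open>Coefficients of row \<open>k\<close> of \<open>A'\<close> in terms of the rows
      of \<open>A t\<close>. Only the coefficient of row \<open>k\<close> itself survives in the
      determinant.\<close>
    define x where "x = A' $ k v* matrix_inv (A t)"
    have "x v* A t = A' $ k"
      unfolding x_def vector_matrix_mul_assoc matrix_inv_inverse[OF inv] by simp
    then have "A' $ k = (\<Sum>i\<in>UNIV. x $ i *s row i (A t))"
      by (auto simp: vec_eq_iff vector_matrix_mult_def row_def mult.commute)
    then have "?R k = (\<chi> i. if i = k then (\<Sum>i\<in>UNIV. x $ i *s row i (A t)) else row i (A t))"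
      by (auto simp: vec_eq_iff row_def)
    then have "det (?R k) = x $ k * det (A t)" by (simp only: cramer_lemma_transpose)
    then show ?thesis by (simp add: x_def vector_matrix_mult_def mult.commute)
  qed
  ultimately show ?thesis by (simp add: det_def sum_distrib_right)
qed

text \<open>Stated over an index set instead of a matrix type because the decomposition into squares
  is an induction removing one index.\<close>

definition positive_form :: "'i set \<Rightarrow> ('i \<Rightarrow> 'i \<Rightarrow> real) \<Rightarrow> bool" where
  "positive_form S H \<longleftrightarrow> (\<forall>i\<in>S. \<forall>j\<in>S. H i j = H j i) \<and>
     (\<forall>x. (\<exists>i\<in>S. x i \<noteq> 0) \<longrightarrow> 0 < (\<Sum>i\<in>S. \<Sum>j\<in>S. x i * H i j * x j))"

lemma positive_form_nonneg:
  assumes "positive_form S H"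
  shows "0 \<le> (\<Sum>i\<in>S. \<Sum>j\<in>S. x i * H i j * x j)"
proof (cases "\<exists>i\<in>S. x i \<noteq> 0")
  case True then show ?thesis using assms by (force simp: positive_form_def intro: less_imp_le)
qed simp

text \<open>The induction step splits off one variable and passes to the Schur complement.\<close>

lemma positive_form_decomposition:
  fixes H :: "'i \<Rightarrow> 'i \<Rightarrow> real"
  assumes "finite S" "positive_form S H"
  shows "\<exists>u :: 'i \<Rightarrow> 'i \<Rightarrow> real. \<forall>i\<in>S. \<forall>k\<in>S. H i k = (\<Sum>a\<in>S. u a i * u a k)"
  using assms
proof (induction S arbitrary: H rule: finite_induct)
  case (insert s S)
  have sym: "H i j = H j i" if "i \<in> insert s S" "j \<in> insert s S" for i j
    using insert.prems that unfolding positive_form_def by blast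
  have pos: "0 < (\<Sum>i\<in>insert s S. \<Sum>j\<in>insert s S. x i * H i j * x j)" if "\<exists>i\<in>insert s S. x i \<noteq> 0" for x
    using insert.prems that unfolding positive_form_def by blast
  have split: "(\<Sum>i\<in>insert s S. \<Sum>j\<in>insert s S. x i * H i j * x j) =
      x s * x s * H s s + 2 * x s * (\<Sum>j\<in>S. H s j * x j) + (\<Sum>i\<in>S. \<Sum>j\<in>S. x i * H i j * x j)" for x
  proof -
    have "(\<Sum>i\<in>S. x i * H i s * x s) = x s * (\<Sum>j\<in>S. H s j * x j)"
      using sym by (auto simp: sum_distrib_left intro!: sum.cong)
    moreover have "(\<Sum>j\<in>S. x s * H s j * x j) = x s * (\<Sum>j\<in>S. H s j * x j)"
      by (simp add: sum_distrib_left mult.assoc)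
    ultimately show ?thesis using insert.hyps by (simp add: sum.distrib algebra_simps)
  qed
  let ?d = "H s s"
  have d: "?d > 0"
  proof -
    \<comment> \<open>The coordinate vector at \<open>s\<close> isolates the diagonal entry
      \<open>H s s\<close>.\<close>
    let ?x = "\<lambda>i. if i = s then 1 else 0 :: real"
    have "\<And>j. j \<in> S \<Longrightarrow> ?x j = 0" using insert.hyps by auto
    then have "(\<Sum>j\<in>S. H s j * ?x j) = 0" "(\<Sum>i\<in>S. \<Sum>j\<in>S. ?x i * H i j * ?x j) = 0"
      by (auto intro!: sum.neutral)
    then show ?thesis using pos[of ?x] unfolding split by simp
  qed
  define H' where "H' i j = H i j - H s i * H s j / ?d" for i j
  have "positive_form S H'"
    unfolding positive_form_def
  proof (intro conjI ballI allI impI)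
    show "H' i j = H' j i" if "i \<in> S" "j \<in> S" for i j
      using sym[of i j] that by (simp add: H'_def mult.commute)
    fix x :: "'i \<Rightarrow> real" assume x: "\<exists>i\<in>S. x i \<noteq> 0"
    define m where "m = (\<Sum>j\<in>S. H s j * x j)"
    \<comment> \<open>The value \<open>- m / ?d\<close> minimizes the quadratic form in the variable
      \<open>s\<close>; the minimum is the value of the Schur complement at
      \<open>x\<close>.\<close>
    define y where "y = x(s := - m / ?d)"
    have y: "y i = x i" if "i \<in> S" for i using that insert.hyps by (auto simp: y_def)
    have "(\<Sum>i\<in>S. \<Sum>j\<in>S. x i * H' i j * x j) =
        (\<Sum>i\<in>S. \<Sum>j\<in>S. x i * H i j * x j) - (\<Sum>i\<in>S. \<Sum>j\<in>S. (H s i * x i) * (H s j * x j)) / ?d"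
      by (simp add: H'_def algebra_simps sum_subtractf sum_divide_distrib)
    also have "(\<Sum>i\<in>S. \<Sum>j\<in>S. (H s i * x i) * (H s j * x j)) = m * m"
      by (simp add: m_def sum_product)
    also have "(\<Sum>i\<in>S. \<Sum>j\<in>S. x i * H i j * x j) - m * m / ?d =
        (\<Sum>i\<in>insert s S. \<Sum>j\<in>insert s S. y i * H i j * y j)"
    proof -
      have "(\<Sum>j\<in>S. H s j * y j) = m" "(\<Sum>i\<in>S. \<Sum>j\<in>S. y i * H i j * y j) = (\<Sum>i\<in>S. \<Sum>j\<in>S. x i * H i j * x j)"
        using y by (auto simp: m_def intro!: sum.cong)
      moreover have "y s = - m / ?d" by (simp add: y_def)
      ultimately show ?thesis unfolding split using d by (simp add: field_simps)
    qed
    also have "\<dots> > 0" by (rule pos) (use x y in auto)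
    finally show "0 < (\<Sum>i\<in>S. \<Sum>j\<in>S. x i * H' i j * x j)" .
  qed
  then obtain u where u: "\<And>i k. i \<in> S \<Longrightarrow> k \<in> S \<Longrightarrow> H' i k = (\<Sum>a\<in>S. u a i * u a k)"
    using insert.IH by blast
  \<comment> \<open>One Cholesky step: the new row \<open>s\<close> accounts for all entries
    involving \<open>s\<close> and for the term subtracted in \<open>H'\<close>, so the old rows are
    extended by zero at \<open>s\<close>.\<close>
  define u' where "u' a i = (if a = s then H s i / sqrt ?d else if i = s then 0 else u a i)" for a i
  have "H i k = (\<Sum>a\<in>insert s S. u' a i * u' a k)" if "i \<in> insert s S" "k \<in> insert s S" for i k
  proof -
    have ss: "u' s i * u' s k = H s i * H s k / ?d" using d by (simp add: u'_def)
    have S: "(\<Sum>a\<in>S. u' a i * u' a k) = (if i = s \<or> k = s then 0 else \<Sum>a\<in>S. u a i * u a k)"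
      using insert.hyps by (auto simp: u'_def intro!: sum.neutral sum.cong)
    show ?thesis
      using that insert.hyps d ss S u[of i k] sym[of i k] by (auto simp: H'_def)
  qed
  then show ?case by blast
qed simp

text \<open>A sum of squares is a factorization of \<open>A\<close> as a transpose times a matrix,
  so its determinant is a square, nonzero because positivity makes the kernel trivial. The inverse
  is symmetric and its quadratic form is that of \<open>A\<close> after a change of
  variable.\<close>

lemma positive_form_matrix:
  fixes A :: "real^'n^'n"
  assumes "positive_form UNIV (\<lambda>i j. A $ i $ j)"
  shows "det A > 0" and "positive_form UNIV (\<lambda>i j. matrix_inv A $ i $ j)"
proof -
  have quad: "x \<bullet> (A *v x) = (\<Sum>i\<in>UNIV. \<Sum>j\<in>UNIV. x $ i * A $ i $ j * x $ j)" for x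
    by (simp add: inner_vec_def matrix_vector_mult_def sum_distrib_left mult.assoc)
  have pos: "x \<bullet> (A *v x) > 0" if "x \<noteq> 0" for x
    using assms that unfolding quad positive_form_def by (auto simp: vec_eq_iff)
  have "A *v x \<noteq> 0" if "x \<noteq> 0" for x using pos[OF that] by auto
  then have inv: "invertible A"
    by (metis invertible_left_inverse matrix_left_invertible_ker)
  obtain u :: "'n \<Rightarrow> 'n \<Rightarrow> real" where u: "\<And>i k. A $ i $ k = (\<Sum>a\<in>UNIV. u a i * u a k)"
    using positive_form_decomposition[OF finite assms] by auto
  have "A = transpose (\<chi> a i. u a i) ** (\<chi> a i. u a i)"
    by (simp add: vec_eq_iff u matrix_matrix_mult_def transpose_def)
  then have "det A = det (\<chi> a i. u a i) * det (\<chi> a i. u a i)"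
    by (metis det_mul det_transpose)
  moreover have "det A \<noteq> 0" using inv invertible_det_nz by blast
  ultimately show "det A > 0" by (metis less_eq_real_def not_real_square_gt_zero zero_le_square)
  let ?B = "matrix_inv A"
  have sym: "transpose A = A"
    using assms by (simp add: positive_form_def transpose_def vec_eq_iff)
  have "A ** transpose ?B = mat 1"
    using arg_cong[OF matrix_inv_inverse(2)[OF inv], of transpose]
    by (simp add: matrix_transpose_mul sym transpose_mat)
  then have "?B ** (A ** transpose ?B) = ?B" by simp
  then have symB: "transpose ?B = ?B"
    by (simp add: matrix_mul_assoc matrix_inv_inverse[OF inv])
  show "positive_form UNIV (\<lambda>i j. ?B $ i $ j)"
    unfolding positive_form_def
  proof (intro conjI ballI allI impI)
    show "?B $ i $ j = ?B $ j $ i" for i j using symB by (simp add: transpose_def vec_eq_iff)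
    fix x :: "'n \<Rightarrow> real" assume "\<exists>i\<in>UNIV. x i \<noteq> 0"
    then have x: "(\<chi> i. x i) \<noteq> 0" by (auto simp: vec_eq_iff)
    \<comment> \<open>With \<open>A *v y = x\<close>, the value of the inverse form at
      \<open>x\<close> becomes the value of \<open>A\<close> at \<open>y\<close>.\<close>
    define y where "y = ?B *v (\<chi> i. x i)"
    have Ay: "A *v y = (\<chi> i. x i)"
      by (simp add: y_def matrix_vector_mul_assoc matrix_inv_inverse[OF inv])
    with x have "y \<noteq> 0" by auto
    from pos[OF this] have "0 < (\<chi> i. x i) \<bullet> (?B *v (\<chi> i. x i))"
      unfolding Ay by (simp add: y_def inner_commute)
    also have "\<dots> = (\<Sum>i\<in>UNIV. \<Sum>j\<in>UNIV. x i * ?B $ i $ j * x j)"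
      by (simp add: inner_vec_def matrix_vector_mult_def sum_distrib_left mult.assoc)
    finally show "0 < (\<Sum>i\<in>UNIV. \<Sum>j\<in>UNIV. x i * ?B $ i $ j * x j)" .
  qed
qed

section \<open>Traces and contractions with the inverse metric\<close>

context
  fixes N :: "('a, real^'n) mfd" and g c p
  assumes g: "riemannian_metric N g" and c: "c \<in> atlas N" "p \<in> fst c"
begin

lemma positive_form_gmat: "positive_form UNIV (\<lambda>i j. gmat g c p $ i $ j)"
  unfolding positive_form_def
proof (intro conjI ballI allI impI)
  have lin: "linear (g c p v)" "linear (\<lambda>v. g c p v w)" for v w
    using g c by (auto simp: riemannian_metric_def tensor2_def bilinear_def)
  show "gmat g c p $ i $ j = gmat g c p $ j $ i" for i j
    using g c by (simp add: gmat_def comp2_def riemannian_metric_def)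
  fix x :: "'n \<Rightarrow> real" assume "\<exists>i\<in>UNIV. x i \<noteq> 0"
  then have "(\<chi> i. x i) \<noteq> 0" by (auto simp: vec_eq_iff)
  then have "0 < g c p (\<chi> i. x i) (\<chi> i. x i)" using g c by (simp add: riemannian_metric_def)
  also have "(\<chi> i. x i) = (\<Sum>i\<in>UNIV. x i *\<^sub>R axis i 1)"
    using basis_expansion[of "\<chi> i. x i"] by (simp add: scalar_mult_eq_scaleR)
  also have "g c p (\<Sum>i\<in>UNIV. x i *\<^sub>R axis i 1) (\<Sum>i\<in>UNIV. x i *\<^sub>R axis i 1) =
      (\<Sum>i\<in>UNIV. \<Sum>j\<in>UNIV. x i * gmat g c p $ i $ j * x j)"
    unfolding linear_sum[OF lin(2)] unfolding linear_sum[OF lin(1)]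
    by (simp add: linear_cmul[OF lin(1)] linear_cmul[OF lin(2)] gmat_def comp2_def mult_ac)
  finally show "0 < (\<Sum>i\<in>UNIV. \<Sum>j\<in>UNIV. x i * gmat g c p $ i $ j * x j)" .
qed

lemma det_gmat_pos: "det (gmat g c p) > 0"
  by (rule positive_form_matrix(1)[OF positive_form_gmat])

lemma invertible_gmat: "invertible (gmat g c p)"
  using det_gmat_pos invertible_det_nz by force

lemma positive_form_ginv: "positive_form UNIV (\<lambda>i j. ginv g c i j p)"
  unfolding ginv_def by (rule positive_form_matrix(2)[OF positive_form_gmat])

lemma ginv_sym: "ginv g c i j p = ginv g c j i p"
  using positive_form_ginv by (simp add: positive_form_def)

lemma tr_g_comp2: "tr_g g c (comp2 g c) p = CARD('n)"
proof -
  have "tr_g g c (comp2 g c) p = (\<Sum>i\<in>UNIV. \<Sum>j\<in>UNIV. matrix_inv (gmat g c p) $ i $ j * gmat g c p $ j $ i)"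
    using positive_form_gmat by (simp add: tr_g_def ginv_def positive_form_def gmat_def)
  also have "\<dots> = (\<Sum>i\<in>UNIV. (matrix_inv (gmat g c p) ** gmat g c p) $ i $ i)"
    by (simp add: matrix_matrix_mult_def)
  finally show ?thesis by (simp add: matrix_inv_inverse[OF invertible_gmat] mat_def)
qed

text \<open>One of the two inverse metrics is written as a sum of squares, which turns each pair of
  slots into vectors \<open>y a\<close>; the other is then evaluated on each \<open>y a\<close> as a
  positive form.\<close>

lemma normsq_nonneg: "normsq g F c p \<ge> 0"
proof -
  obtain u :: "'n \<Rightarrow> 'n \<Rightarrow> real" where u: "\<And>i k. ginv g c i k p = (\<Sum>a\<in>UNIV. u a i * u a k)"
    using positive_form_decomposition[OF finite positive_form_ginv] by auto
  define y where "y a i = (\<Sum>j\<in>UNIV. u a j * comp2 F c i j p)" for a i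
  have inner: "(\<Sum>j\<in>UNIV. \<Sum>l\<in>UNIV. ginv g c j l p * comp2 F c i j p * comp2 F c k l p) = (\<Sum>a\<in>UNIV. y a i * y a k)"
    for i k
  proof -
    have "(\<Sum>a\<in>UNIV. y a i * y a k) =
        (\<Sum>a\<in>UNIV. \<Sum>j\<in>UNIV. \<Sum>l\<in>UNIV. u a j * comp2 F c i j p * (u a l * comp2 F c k l p))"
      by (simp add: y_def sum_product)
    also have "\<dots> = (\<Sum>j\<in>UNIV. \<Sum>a\<in>UNIV. \<Sum>l\<in>UNIV. u a j * comp2 F c i j p * (u a l * comp2 F c k l p))"
      by (rule sum.swap)
    also have "\<dots> = (\<Sum>j\<in>UNIV. \<Sum>l\<in>UNIV. \<Sum>a\<in>UNIV. u a j * comp2 F c i j p * (u a l * comp2 F c k l p))"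
      by (intro sum.cong refl sum.swap)
    finally show ?thesis by (simp add: u sum_distrib_left sum_distrib_right mult_ac)
  qed
  have "normsq g F c p = (\<Sum>i\<in>UNIV. \<Sum>k\<in>UNIV. \<Sum>j\<in>UNIV. \<Sum>l\<in>UNIV.
      ginv g c i k p * ginv g c j l p * comp2 F c i j p * comp2 F c k l p)"
    unfolding normsq_def by (intro sum.cong refl sum.swap)
  also have "\<dots> = (\<Sum>i\<in>UNIV. \<Sum>k\<in>UNIV. ginv g c i k p *
      (\<Sum>j\<in>UNIV. \<Sum>l\<in>UNIV. ginv g c j l p * comp2 F c i j p * comp2 F c k l p))"
    by (simp add: sum_distrib_left mult.assoc)
  also have "\<dots> = (\<Sum>i\<in>UNIV. \<Sum>k\<in>UNIV. \<Sum>a\<in>UNIV. y a i * ginv g c i k p * y a k)"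
    unfolding inner by (simp add: sum_distrib_left mult_ac)
  also have "\<dots> = (\<Sum>i\<in>UNIV. \<Sum>a\<in>UNIV. \<Sum>k\<in>UNIV. y a i * ginv g c i k p * y a k)"
    by (intro sum.cong refl sum.swap)
  also have "\<dots> = (\<Sum>a\<in>UNIV. \<Sum>i\<in>UNIV. \<Sum>k\<in>UNIV. y a i * ginv g c i k p * y a k)"
    by (rule sum.swap)
  also have "\<dots> \<ge> 0"
    by (intro sum_nonneg positive_form_nonneg positive_form_ginv)
  finally show ?thesis .
qed

text \<open>Both sides contract the first slots of the two copies of \<open>F\<close> with each
  other, and likewise the second slots; only the names and order of the summation indices
  differ.\<close>

lemma tr_g_j_op: "tr_g g c (j_op g F c) p = normsq g F c p"
proof -
  have "tr_g g c (j_op g F c) p = (\<Sum>i\<in>UNIV. \<Sum>j\<in>UNIV. \<Sum>k\<in>UNIV. \<Sum>l\<in>UNIV.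
      ginv g c i j p * ginv g c k l p * comp2 F c i k p * comp2 F c j l p)"
    by (simp add: tr_g_def j_op_def sum_distrib_left mult.assoc)
  also have "\<dots> = (\<Sum>i\<in>UNIV. \<Sum>k\<in>UNIV. \<Sum>j\<in>UNIV. \<Sum>l\<in>UNIV.
      ginv g c i j p * ginv g c k l p * comp2 F c i k p * comp2 F c j l p)"
    by (intro sum.cong refl sum.swap)
  finally show ?thesis by (simp add: normsq_def)
qed

text \<open>Each bracket has the shape \<open>T - a * tr T * g\<close>, with \<open>a\<close> equal
  to 1/2, 1 and 1/2. As the trace of \<open>g\<close> is the dimension n, its trace is
  \<open>(1 - a * n) * tr T\<close>.\<close>

lemma tr_g_rhs_g: "tr_g g c (rhs_g g h F c) p =
    1/2 * (hroot h p * (1 - CARD('n) / 2) * scal g c p)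
    - 1/2 * ((1 - real CARD('n)) * laplacian g c (hroot h) p)
    - 1/8 * (hinv h p * (1 - CARD('n) / 2) * normsq g F c p)"
proof -
  have "tr_g g c (rhs_g g h F c) p =
      1/2 * hroot h p * (tr_g g c (ricci g c) p - 1/2 * scal g c p * tr_g g c (comp2 g c) p)
    - 1/2 * (tr_g g c (hess g c (hroot h)) p - laplacian g c (hroot h) p * tr_g g c (comp2 g c) p)
    - 1/8 * hinv h p * (tr_g g c (j_op g F c) p - 1/2 * normsq g F c p * tr_g g c (comp2 g c) p)"
    unfolding tr_g_def rhs_g_def sum_distrib_left sum_subtractf[symmetric]
    by (intro sum.cong refl) (simp add: algebra_simps)
  then show ?thesis
    unfolding tr_g_comp2 tr_g_j_op scal_def[symmetric] laplacian_def[symmetric]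
    by (simp add: algebra_simps)
qed

end

section \<open>Evolution of the volume form and stationary limits\<close>

lemma has_real_derivative_vol_form:
  fixes N :: "('a, real^'n) mfd"
  assumes g: "riemannian_metric N (g t)" and c: "c \<in> atlas N" "p \<in> fst c"
    and g': "\<And>i j. ((\<lambda>s. comp2 (g s) c i j p) has_real_derivative T i j p) (at t within I)"
  shows "((\<lambda>s. vol_form (g s) c p v) has_real_derivative
     1/2 * tr_g (g t) c T p * vol_form (g t) c p v) (at t within I)"
proof -
  let ?G = "\<lambda>s. gmat (g s) c p"
  have det: "det (?G t) > 0" by (rule det_gmat_pos[OF g c])
  have "((\<lambda>s. det (?G s)) has_real_derivative
    (\<Sum>i\<in>UNIV. \<Sum>j\<in>UNIV. (\<chi> i j. T i j p) $ i $ j * matrix_inv (?G t) $ j $ i) * det (?G t)) (at t within I)"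
    by (rule has_real_derivative_det[where A = ?G, OF _ invertible_gmat[OF g c]]) (use g' in \<open>simp add: gmat_def\<close>)
  \<comment> \<open>Jacobi's formula pairs the entry \<open>i j\<close> with the transposed entry of
    the inverse; symmetry of the inverse metric turns this into the trace.\<close>
  also have "(\<Sum>i\<in>UNIV. \<Sum>j\<in>UNIV. (\<chi> i j. T i j p) $ i $ j * matrix_inv (?G t) $ j $ i) = tr_g (g t) c T p"
    using ginv_sym[OF g c] by (simp add: tr_g_def ginv_def mult.commute)
  finally have "((\<lambda>s. sqrt (det (?G s))) has_real_derivative
      inverse (sqrt (det (?G t))) / 2 * (tr_g (g t) c T p * det (?G t))) (at t within I)"
    by (rule DERIV_chain2[where g = "\<lambda>s. det (?G s)", OF DERIV_real_sqrt[OF det]])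
  moreover have "inverse (sqrt (det (?G t))) / 2 * (tr_g (g t) c T p * det (?G t)) =
      1/2 * tr_g (g t) c T p * sqrt (det (?G t))"
  proof -
    \<comment> \<open>Writing the determinant as \<open>r * r\<close> makes the division by its root
      a cancellation.\<close>
    obtain r where r: "r > 0" "det (?G t) = r * r" "sqrt (det (?G t)) = r"
      using det real_sqrt_gt_zero[OF det] by (metis less_imp_le real_sqrt_mult_self abs_of_pos)
    show ?thesis unfolding r(3) unfolding r(2) using r(1) by (simp add: field_simps)
  qed
  ultimately have "((\<lambda>s. sqrt (det (?G s))) has_real_derivative 1/2 * tr_g (g t) c T p * sqrt (det (?G t))) (at t within I)"
    by (simp only:)
  from DERIV_cmult_right[OF this, of "det (\<chi> i j. v j $ i)"] show ?thesis
    by (simp add: vol_form_def mult.assoc)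
qed

text \<open>Split \<open>h powr (-2)\<close> as \<open>h powr (-1/2)\<close> times
  \<open>h powr (-3/2)\<close> and cancel the positive common factor; the constant 1/2 is the ratio
  of 1/8 to 1/4.\<close>

lemma rhs_h_zero_scal:
  assumes "rhs_h g h F c p = 0" "h p > 0"
  shows "scal g c p = - 1/2 * h p powr (-3/2) * normsq g F c p"
proof -
  have "h p powr (-2) = h p powr (-1/2) * h p powr (-3/2)"
    by (simp flip: powr_add)
  then have "h p powr (-1/2) * (scal g c p + 1/2 * h p powr (-3/2) * normsq g F c p) = 0"
    using assms(1) by (simp add: rhs_h_def algebra_simps)
  then show ?thesis using assms(2) by simp
qed

theorem corollary3:
  fixes N :: "('a, real^6) mfd"
    and P :: "('p, 'e::euclidean_space) mfd"
    and \<pi> :: "'p \<Rightarrow> 'a"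
    and act :: "complex \<Rightarrow> 'p \<Rightarrow> 'p"
    and I :: "real set"
    and g :: "real \<Rightarrow> ('a, real^6) cov2"
    and h :: "real \<Rightarrow> 'a \<Rightarrow> real"
    and \<eta> :: "real \<Rightarrow> ('p, 'e) cov1"
    and F :: "real \<Rightarrow> ('a, real^6) cov2"
  assumes "closed_manifold N"
    and "principal_circle_bundle P N \<pi> act"
    and "is_interval I" "interior I \<noteq> {}"
    and "flow_solution P N \<pi> act I g h \<eta> F"
  shows
    "((\<forall>t\<in>I. closed_2form N (F t)) \<and>
     (\<forall>s\<in>I. \<forall>t\<in>I. de_rham_class2 N (F s) = de_rham_class2 N (F t))) \<and>
     (\<forall>g' h' \<eta>' F'. stationary_limit P N \<pi> act g' h' \<eta>' F' \<longrightarrow>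
       (\<forall>c\<in>atlas N. \<forall>p\<in>fst c.
          (\<forall>v. codiff2 g' (scale2 (hinv h') F') c p v = 0) \<and>
          scal g' c p = - 1/2 * h' p powr (-3/2) * normsq g' F' c p \<and>
          scal g' c p \<le> 0)) \<and>
     (\<forall>t\<in>I. \<forall>c\<in>atlas N. \<forall>p\<in>fst c. \<forall>v.
       ((\<lambda>s. vol_form (g s) c p v) has_real_derivative
          (- 1/2 * hroot (h t) p * scal (g t) c p + 5/4 * laplacian (g t) c (hroot (h t)) p
             + 1/8 * hinv (h t) p * normsq (g t) (F t) c p) * vol_form (g t) c p v)
         (at t within I))"
proof (intro conjI ballI allI impI)
  interpret circle_bundle P N \<pi> act by standard (rule assms(2))
  have data: "flow_data P N \<pi> act (g t) (h t) (\<eta> t) (F t)" if "t \<in> I" for t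
    using assms(5) that by (simp add: flow_solution_def)
  then have conn: "connection_form P act (\<eta> t)" "curvature_form P N \<pi> (\<eta> t) (F t)"
    and metric: "riemannian_metric N (g t)" if "t \<in> I" for t
    using that by (simp_all add: flow_data_def)
  show "closed_2form N (F t)" if "t \<in> I" for t
    by (rule curvature_form_closed[OF _ conn(2)[OF that]]) (use conn(1)[OF that] in \<open>simp add: connection_form_def\<close>)
  show "de_rham_class2 N (F s) = de_rham_class2 N (F t)" if "s \<in> I" "t \<in> I" for s t
    using de_rham_class_curvature_le[OF conn(1)[OF that(1)] conn(1)[OF that(2)] conn(2)[OF that(1)] conn(2)[OF that(2)]]
      de_rham_class_curvature_le[OF conn(1)[OF that(2)] conn(1)[OF that(1)] conn(2)[OF that(2)] conn(2)[OF that(1)]]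
    by (rule equalityI)
  show "((\<lambda>s. vol_form (g s) c p v) has_real_derivative
          (- 1/2 * hroot (h t) p * scal (g t) c p + 5/4 * laplacian (g t) c (hroot (h t)) p
             + 1/8 * hinv (h t) p * normsq (g t) (F t) c p) * vol_form (g t) c p v) (at t within I)"
    if t: "t \<in> I" and c: "c \<in> atlas N" "p \<in> fst c" for t c p v
  proof -
    have "((\<lambda>s. vol_form (g s) c p v) has_real_derivative
        1/2 * tr_g (g t) c (rhs_g (g t) (h t) (F t) c) p * vol_form (g t) c p v) (at t within I)"
      by (rule has_real_derivative_vol_form[where g = g, OF metric[OF t] c])
        (use assms(5) t c in \<open>simp add: flow_solution_def\<close>)
    \<comment> \<open>In dimension 6 the trace factors are -2, -5 and -2. Half of 1/2, -1/2 and -1/8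
      times these gives -1/2, 5/4 and 1/8.\<close>
    then show ?thesis
      unfolding tr_g_rhs_g[OF metric[OF t] c] by (simp add: algebra_simps)
  qed
  fix g' h' \<eta>' F' c p assume st: "stationary_limit P N \<pi> act g' h' \<eta>' F'" and c: "c \<in> atlas N" "p \<in> fst c"
  then have zero: "rhs_h g' h' F' c p = 0" "\<And>v. rhs_eta g' h' F' c p v = 0"
    by (simp_all add: stationary_limit_def)
  have metric': "riemannian_metric N g'" and h': "h' p > 0"
    using st charted_topspace[OF charted_N c] by (simp_all add: stationary_limit_def flow_data_def)
  show "codiff2 g' (scale2 (hinv h') F') c p v = 0" for v
    using zero(2)[of v] by (simp add: rhs_eta_def)
  show scal: "scal g' c p = - 1/2 * h' p powr (-3/2) * normsq g' F' c p"
    by (rule rhs_h_zero_scal[OF zero(1) h'])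
  show "scal g' c p \<le> 0"
    unfolding scal using normsq_nonneg[OF metric' c, of F'] by simp
qed

end
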